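(* Let $n\ge1$ be an integer, $\mathcal{N}=[(z-w)^n]^\perp=H^2(\mathbb{D}^2)\ominus[(z-w)^n]$ and $S_z=P_{\mathcal{N}}T_z|_{\mathcal{N}}$. Then $S_z$ is irreducible.
   Context: $H^2(\mathbb{D}^2)$ is the Hardy space over the bidisk, with coordinates $(z,w)$; $[p]$ is the closure of $p\,\mathbb{C}[z,w]$ in $H^2(\mathbb{D}^2)$; $T_z$ is multiplication by $z$; $P_{\mathcal{N}}$ is the orthogonal projection onto $\mathcal{N}$. An operator $T$ is irreducible if the only closed subspaces invariant under both $T$ and $T^*$ are $\{0\}$ and the whole space. *)

theory Defs
  imports "HOL-Analysis.Analysis" "HOL-Computational_Algebra.Polynomial"
begin

definition bidisk :: "(complex \<times> complex) set" where
  "bidisk = ball 0 1 \<times> ball 0 1"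

text \<open>
  Functions on the bidisk are represented by total functions that vanish off the bidisk, so that
  equality on the bidisk is equality in HOL.
\<close>

type_synonym bifun = "complex \<times> complex \<Rightarrow> complex"

definition has_power_series :: "bifun \<Rightarrow> (nat \<times> nat \<Rightarrow> complex) \<Rightarrow> bool" where
  "has_power_series f a \<longleftrightarrow>
     (\<forall>(z, w) \<in> bidisk. ((\<lambda>(i, j). a (i, j) * z ^ i * w ^ j) has_sum f (z, w)) UNIV)"

definition hardy2 :: "bifun set" where
  "hardy2 = {f. (\<forall>x. x \<notin> bidisk \<longrightarrow> f x = 0) \<and>
     (\<exists>a. (\<lambda>k. (cmod (a k))\<^sup>2) summable_on UNIV \<and> has_power_series f a)}"

text \<open>The power series coefficients of a function on the bidisk are unique if they exist.\<close>

definition taylor_coeff :: "bifun \<Rightarrow> nat \<times> nat \<Rightarrow> complex" where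
  "taylor_coeff f = (THE a. has_power_series f a)"

definition h2_inner :: "bifun \<Rightarrow> bifun \<Rightarrow> complex" where
  "h2_inner f g = (\<Sum>\<^sub>\<infinity>k. taylor_coeff f k * cnj (taylor_coeff g k))"

definition h2_norm :: "bifun \<Rightarrow> real" where
  "h2_norm f = sqrt (Re (h2_inner f f))"

definition h2_closure :: "bifun set \<Rightarrow> bifun set" where
  "h2_closure A = {f \<in> hardy2. \<forall>e>0. \<exists>g\<in>A. h2_norm (\<lambda>x. f x - g x) < e}"

definition h2_orth :: "bifun set \<Rightarrow> bifun set" where
  "h2_orth A = {f \<in> hardy2. \<forall>g\<in>A. h2_inner f g = 0}"

definition h2_closed_subspace :: "bifun set \<Rightarrow> bool" where
  "h2_closed_subspace M \<longleftrightarrow>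
     M \<subseteq> hardy2 \<and> (\<lambda>_. 0) \<in> M \<and>
     (\<forall>f\<in>M. \<forall>g\<in>M. (\<lambda>x. f x + g x) \<in> M) \<and>
     (\<forall>c. \<forall>f\<in>M. (\<lambda>x. c * f x) \<in> M) \<and>
     h2_closure M = M"

text \<open>Only meaningful when \<open>N\<close> is a closed subspace and \<open>f\<close> lies in \<open>hardy2\<close>.\<close>

definition h2_proj :: "bifun set \<Rightarrow> bifun \<Rightarrow> bifun" where
  "h2_proj N f = (THE g. g \<in> N \<and> (\<forall>h\<in>N. h2_inner (\<lambda>x. f x - g x) h = 0))"

definition mult_z :: "bifun \<Rightarrow> bifun" where
  "mult_z f = (\<lambda>(z, w). z * f (z, w))"

text \<open>
  An operator on a closed subspace \<open>N\<close> is a function whose values on \<open>N\<close> are the only relevant ones.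
\<close>

definition compression :: "bifun set \<Rightarrow> (bifun \<Rightarrow> bifun) \<Rightarrow> bifun \<Rightarrow> bifun" where
  "compression N T f = h2_proj N (T f)"

definition adjoint_on :: "bifun set \<Rightarrow> (bifun \<Rightarrow> bifun) \<Rightarrow> bifun \<Rightarrow> bifun" where
  "adjoint_on N T g = (THE h. h \<in> N \<and> (\<forall>f\<in>N. h2_inner (T f) g = h2_inner f h))"

definition irreducible_on :: "bifun set \<Rightarrow> (bifun \<Rightarrow> bifun) \<Rightarrow> bool" where
  "irreducible_on N T \<longleftrightarrow>
     (\<forall>M. h2_closed_subspace M \<and> M \<subseteq> N \<and>
          (\<forall>f\<in>M. T f \<in> M) \<and> (\<forall>f\<in>M. adjoint_on N T f \<in> M)
        \<longrightarrow> M = {\<lambda>_. 0} \<or> M = N)"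

text \<open>
  The ring of polynomials in $z$ and $w$ is rendered as polynomials in $w$ whose coefficients are
  polynomials in $z$.
\<close>

definition var_z :: "complex poly poly" where
  "var_z = [:[:0, 1:]:]"

definition var_w :: "complex poly poly" where
  "var_w = [:0, 1:]"

definition bipoly_fun :: "complex poly poly \<Rightarrow> bifun" where
  "bipoly_fun p = (\<lambda>(z, w). if (z, w) \<in> bidisk then poly (poly p [:w:]) z else 0)"

definition submodule_gen :: "complex poly poly \<Rightarrow> bifun set" where
  "submodule_gen p = h2_closure {bipoly_fun (p * q) | q. True}"

end

theory Submission
  imports Defs "HOL-Complex_Analysis.Cauchy_Integral_Formula"
begin

text \<open>
  In terms of Taylor coefficients, the space \<open>N\<close> is the kernel of \<open>D\<^sup>n\<close> in \<open>\<ell>\<^sup>2(\<nat>\<^sup>2)\<close>, where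
  \<open>(D a)(i, j) = a (i + 1, j) - a (i, j + 1)\<close> is the adjoint of multiplication by \<open>z - w\<close>, and the
  adjoint of \<open>S\<^sub>z\<close> is the backward shift \<open>L\<close> in the first variable. Membership in \<open>N\<close> is decided
  degree by degree and imposes no condition in degrees below \<open>n\<close>, so the kernel of \<open>L\<close> in \<open>N\<close> is
  spanned by \<open>1, w, \<dots>, w\<^sup>n\<^sup>-\<^sup>1\<close>, and \<open>f - L (S\<^sub>z f)\<close> is for such an \<open>f\<close> the
  \<open>w\<^sup>n\<^sup>-\<^sup>1\<close>-coefficient of \<open>f\<close> times a nonzero multiple of \<open>u = L ((z - w)\<^sup>n)\<close>.

  Let \<open>K\<close> and \<open>K'\<close> be complementary reducing subspaces. The two components of \<open>w\<^sup>n\<^sup>-\<^sup>1\<close> lie in the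
  kernel of \<open>L\<close>, and one of them has a nonzero \<open>w\<^sup>n\<^sup>-\<^sup>1\<close>-coefficient, so \<open>u\<close> lies in \<open>K\<close> or in
  \<open>K'\<close>, say in \<open>K'\<close>. All coefficients of \<open>u\<close> in its degree are nonzero, so pairing with the
  vectors \<open>L\<^sup>k u\<close> shows that \<open>K\<close> meets the kernel of \<open>L\<close> trivially. As \<open>L\<close> is nilpotent on
  polynomials, the \<open>K\<close>-components of the polynomials in \<open>N\<close> vanish, hence \<open>K = 0\<close>.
\<close>

section \<open>Square-summable families\<close>

definition ell2 :: "('i \<Rightarrow> complex) set" where
  "ell2 = {a. (\<lambda>k. (cmod (a k))\<^sup>2) summable_on UNIV}"

text \<open>\<open>infsum\<close> is 0 on families that are not summable, so \<open>ip\<close> is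
  total, and its symmetry and homogeneity hold for all families.\<close>

definition ip :: "('i \<Rightarrow> complex) \<Rightarrow> ('i \<Rightarrow> complex) \<Rightarrow> complex" where
  "ip a b = (\<Sum>\<^sub>\<infinity>k. a k * cnj (b k))"

definition nsq :: "('i \<Rightarrow> complex) \<Rightarrow> real" where
  "nsq a = (\<Sum>\<^sub>\<infinity>k. (cmod (a k))\<^sup>2)"

lemma ell2_bound:
  assumes "\<And>F. finite F \<Longrightarrow> (\<Sum>k\<in>F. (cmod (a k))\<^sup>2) \<le> B"
  shows "a \<in> ell2" "nsq a \<le> B"
proof -
  show *: "a \<in> ell2"
    unfolding ell2_def mem_Collect_eq
    by (rule nonneg_bdd_above_summable_on) (auto intro!: bdd_aboveI2[where M = B] assms)
  then show "nsq a \<le> B"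
    unfolding nsq_def ell2_def using assms by (intro infsum_le_finite_sums) auto
qed

lemma sum_le_nsq:
  assumes "a \<in> ell2" "finite F"
  shows "(\<Sum>k\<in>F. (cmod (a k))\<^sup>2) \<le> nsq a"
  using assms unfolding nsq_def ell2_def by (intro finite_sum_le_infsum) auto

lemma nsq_nonneg: "nsq a \<ge> 0"
  unfolding nsq_def by (intro infsum_nonneg) auto

lemma ell2_zero [simp]: "(\<lambda>_. 0) \<in> ell2"
  by (simp add: ell2_def)

lemma ell2_scale [intro]: "a \<in> ell2 \<Longrightarrow> (\<lambda>k. c * a k) \<in> ell2"
  unfolding ell2_def by (auto simp: norm_mult power_mult_distrib intro!: summable_on_cmult_right)

lemma ell2_add [intro]:
  assumes "a \<in> ell2" "b \<in> ell2"
  shows "(\<lambda>k. a k + b k) \<in> ell2"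
proof (rule ell2_bound)
  fix F :: "'a set" assume F: "finite F"
  have *: "(cmod (x + y))\<^sup>2 \<le> 2 * (cmod x)\<^sup>2 + 2 * (cmod y)\<^sup>2" for x y :: complex
  proof -
    have "(cmod (x + y))\<^sup>2 \<le> (cmod x + cmod y)\<^sup>2"
      by (intro power_mono norm_triangle_ineq) auto
    also have "\<dots> \<le> 2 * (cmod x)\<^sup>2 + 2 * (cmod y)\<^sup>2"
      using zero_le_power2[of "cmod x - cmod y"] by (simp add: power2_sum power2_diff)
    finally show ?thesis .
  qed
  have "(\<Sum>k\<in>F. (cmod (a k + b k))\<^sup>2) \<le> (\<Sum>k\<in>F. 2 * (cmod (a k))\<^sup>2 + 2 * (cmod (b k))\<^sup>2)"
    by (intro sum_mono *)
  also have "\<dots> = 2 * (\<Sum>k\<in>F. (cmod (a k))\<^sup>2) + 2 * (\<Sum>k\<in>F. (cmod (b k))\<^sup>2)"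
    by (simp add: sum.distrib sum_distrib_left)
  also have "\<dots> \<le> 2 * nsq a + 2 * nsq b"
    using assms F by (intro add_mono mult_left_mono sum_le_nsq) auto
  finally show "(\<Sum>k\<in>F. (cmod (a k + b k))\<^sup>2) \<le> 2 * nsq a + 2 * nsq b" .
qed

lemma ell2_diff [intro]:
  assumes "a \<in> ell2" "b \<in> ell2"
  shows "(\<lambda>k. a k - b k) \<in> ell2"
  using ell2_add[OF assms(1) ell2_scale[OF assms(2), of "-1"]] by simp

lemma ell2_compose:
  assumes "a \<in> ell2" "inj f"
  shows "(\<lambda>k. a (f k)) \<in> ell2"
proof -
  have "(\<lambda>k. (cmod (a k))\<^sup>2) summable_on range f"
    using assms(1) unfolding ell2_def by (auto intro: summable_on_subset)
  then show ?thesis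
    unfolding ell2_def using summable_on_reindex[OF assms(2), of "\<lambda>k. (cmod (a k))\<^sup>2"]
    by (simp add: o_def)
qed

lemma ell2_finite_support:
  assumes "finite {k. a k \<noteq> 0}"
  shows "a \<in> ell2"
  unfolding ell2_def mem_Collect_eq
  using assms by (subst summable_on_cong_neutral[where T = "{k. a k \<noteq> 0}" and g = "\<lambda>k. (cmod (a k))\<^sup>2"]) auto

lemma ell2_restrict [intro]:
  assumes "a \<in> ell2"
  shows "(\<lambda>k. if P k then a k else 0) \<in> ell2"
proof (rule ell2_bound)
  fix F :: "'a set" assume F: "finite F"
  have "(\<Sum>k\<in>F. (cmod (if P k then a k else 0))\<^sup>2) \<le> (\<Sum>k\<in>F. (cmod (a k))\<^sup>2)"
    by (intro sum_mono) auto
  also have "\<dots> \<le> nsq a" using assms F by (rule sum_le_nsq)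
  finally show "(\<Sum>k\<in>F. (cmod (if P k then a k else 0))\<^sup>2) \<le> nsq a" .
qed

lemma ip_abs_summable:
  assumes "a \<in> ell2" "b \<in> ell2"
  shows "(\<lambda>k. cmod (a k * b k)) summable_on UNIV"
proof (rule summable_on_comparison_test)
  show "(\<lambda>k. (cmod (a k))\<^sup>2 + (cmod (b k))\<^sup>2) summable_on UNIV"
    using assms unfolding ell2_def by (auto intro: summable_on_add)
  show "cmod (a k * b k) \<le> (cmod (a k))\<^sup>2 + (cmod (b k))\<^sup>2" for k
    using sum_squares_bound[of "cmod (a k)" "cmod (b k)"] 
      mult_nonneg_nonneg[OF norm_ge_zero[of "a k"] norm_ge_zero[of "b k"]]
    unfolding norm_mult by linarith
qed auto

lemma ip_summable:
  assumes "a \<in> ell2" "b \<in> ell2"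
  shows "(\<lambda>k. a k * cnj (b k)) summable_on UNIV"
proof -
  have "(\<lambda>k. cnj (b k)) \<in> ell2" using assms(2) by (simp add: ell2_def)
  from ip_abs_summable[OF assms(1) this] show ?thesis
    by (rule abs_summable_summable)
qed

lemma ip_commute: "ip b a = cnj (ip a b)"
  unfolding ip_def by (subst infsum_cnj [symmetric]) (simp add: mult.commute)

lemma ip_add_left:
  assumes "a \<in> ell2" "b \<in> ell2" "c \<in> ell2"
  shows "ip (\<lambda>k. a k + b k) c = ip a c + ip b c"
  unfolding ip_def distrib_right by (intro infsum_add ip_summable assms)

lemma ip_scale_left: "ip (\<lambda>k. x * a k) c = x * ip a c"
  unfolding ip_def mult.assoc by (simp add: infsum_cmult_right')

lemma ip_zero_left [simp]: "ip (\<lambda>_. 0) c = 0"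
  by (simp add: ip_def)

lemma ip_diff_left:
  assumes "a \<in> ell2" "b \<in> ell2" "c \<in> ell2"
  shows "ip (\<lambda>k. a k - b k) c = ip a c - ip b c"
  using ip_add_left[OF assms(1) ell2_scale[OF assms(2), of "-1"] assms(3)]
    ip_scale_left[of "-1" b c] by simp

lemma ip_zero_right [simp]: "ip c (\<lambda>_. 0) = 0"
  by (simp add: ip_def)

lemma ip_diff_right:
  assumes "a \<in> ell2" "b \<in> ell2" "c \<in> ell2"
  shows "ip c (\<lambda>k. a k - b k) = ip c a - ip c b"
  using ip_diff_left[OF assms] by (simp add: ip_commute[of c])

lemma ip_scale_right: "ip c (\<lambda>k. x * a k) = cnj x * ip c a"
  using ip_scale_left[of x a c] by (simp add: ip_commute[of c])

lemma ip_self: "ip a a = of_real (nsq a)"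
proof -
  have "ip a a = (\<Sum>\<^sub>\<infinity>k. of_real ((cmod (a k))\<^sup>2))"
    unfolding ip_def by (rule infsum_cong) (simp only: complex_norm_square)
  also have "\<dots> = of_real (nsq a)"
  proof (cases "a \<in> ell2")
    case True
    then have "((\<lambda>k. (cmod (a k))\<^sup>2) has_sum nsq a) UNIV"
      unfolding nsq_def ell2_def by simp
    then show ?thesis by (intro infsumI) (simp only: has_sum_of_real_iff)
  next
    case False
    then have "\<not> (\<lambda>k. complex_of_real ((cmod (a k))\<^sup>2)) summable_on UNIV"
      using summable_on_Re[of "\<lambda>k. complex_of_real ((cmod (a k))\<^sup>2)"]
      unfolding ell2_def by auto
    with False show ?thesis unfolding nsq_def ell2_def by (simp add: infsum_not_exists)
  qed
  finally show ?thesis .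
qed

lemma ip_self_eq_0:
  assumes "a \<in> ell2" "ip a a = 0"
  shows "a = (\<lambda>_. 0)"
proof
  fix k
  have "(\<Sum>k\<in>{k}. (cmod (a k))\<^sup>2) \<le> nsq a" by (rule sum_le_nsq) (use assms in auto)
  with assms(2) show "a k = 0" by (simp add: ip_self)
qed

lemma ip_finite_support:
  assumes "finite F" "\<And>k. k \<notin> F \<Longrightarrow> a k * cnj (b k) = 0"
  shows "ip a b = (\<Sum>k\<in>F. a k * cnj (b k))"
proof -
  have "ip a b = (\<Sum>\<^sub>\<infinity>k\<in>F. a k * cnj (b k))"
    unfolding ip_def by (rule infsum_cong_neutral) (use assms(2) in auto)
  then show ?thesis using assms(1) by simp
qed

lemma ip_single:
  assumes "\<And>k. k \<noteq> k0 \<Longrightarrow> a k * cnj (b k) = 0"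
  shows "ip a b = a k0 * cnj (b k0)"
  by (subst ip_finite_support[of "{k0}"]) (use assms in auto)

text \<open>With \<open>c = ip a b / nsq b\<close> this expansion yields Cauchy-Schwarz and the
  orthogonality of minimisers, with \<open>c = 1\<close> and \<open>c = -1\<close> the parallelogram
  law.\<close>

lemma nsq_scale_diff:
  assumes "a \<in> ell2" "b \<in> ell2"
  shows "nsq (\<lambda>k. a k - c * b k) = nsq a - 2 * Re (c * ip b a) + (cmod c)\<^sup>2 * nsq b"
proof -
  have "of_real (nsq (\<lambda>k. a k - c * b k)) =
      ip a a - cnj c * ip a b - c * ip b a + c * cnj c * ip b b"
    unfolding ip_self[symmetric] using assms
    by (simp add: ip_diff_left ip_diff_right ip_scale_left ip_scale_right ell2_scale ell2_diff algebra_simps)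
  also have "\<dots> = of_real (nsq a) - (c * ip b a + cnj (c * ip b a)) + c * cnj c * of_real (nsq b)"
    by (simp add: ip_self ip_commute[of b a])
  also have "\<dots> = of_real (nsq a - 2 * Re (c * ip b a) + (cmod c)\<^sup>2 * nsq b)"
    unfolding complex_add_cnj complex_norm_square[symmetric] by simp
  finally show ?thesis by (simp only: of_real_eq_iff)
qed

lemma cauchy_schwarz:
  assumes "a \<in> ell2" "b \<in> ell2"
  shows "(cmod (ip a b))\<^sup>2 \<le> nsq a * nsq b"
proof (cases "nsq b = 0")
  case True
  then have "b = (\<lambda>_. 0)" using ip_self_eq_0[OF assms(2)] by (simp add: ip_self)
  then show ?thesis using True by simp
next
  case False
  then have pos: "nsq b > 0" using nsq_nonneg[of b] by linarith
  have *: "Re (ip a b / nsq b * ip b a) = (cmod (ip a b))\<^sup>2 / nsq b"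
    unfolding times_divide_eq_left ip_commute[of b a] complex_norm_square[symmetric]
    by (simp only: of_real_divide[symmetric] Re_complex_of_real)
  \<comment> \<open>This multiple of \<open>b\<close> is the point of its span nearest to
    \<open>a\<close>.\<close>
  have "0 \<le> nsq (\<lambda>k. a k - (ip a b / nsq b) * b k)" by (rule nsq_nonneg)
  also have "\<dots> = nsq a - 2 * ((cmod (ip a b))\<^sup>2 / nsq b) + (cmod (ip a b))\<^sup>2 / (nsq b)\<^sup>2 * nsq b"
    unfolding nsq_scale_diff[OF assms] * by (simp add: norm_divide power_divide)
  also have "\<dots> = nsq a - (cmod (ip a b))\<^sup>2 / nsq b"
    using pos by (simp add: power2_eq_square)
  finally show ?thesis using pos by (simp add: field_simps)
qed

section \<open>Closed subspaces and orthogonal projection\<close>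

definition subsp :: "('i \<Rightarrow> complex) set \<Rightarrow> bool" where
  "subsp K \<longleftrightarrow> K \<subseteq> ell2 \<and> (\<lambda>_. 0) \<in> K \<and> (\<forall>a\<in>K. \<forall>b\<in>K. (\<lambda>k. a k + b k) \<in> K) \<and>
     (\<forall>c. \<forall>a\<in>K. (\<lambda>k. c * a k) \<in> K)"

definition closed_subsp :: "('i \<Rightarrow> complex) set \<Rightarrow> bool" where
  "closed_subsp K \<longleftrightarrow> subsp K \<and>
     (\<forall>a\<in>ell2. (\<forall>e>0. \<exists>g\<in>K. nsq (\<lambda>k. a k - g k) < e) \<longrightarrow> a \<in> K)"

lemma subsp_add: "subsp K \<Longrightarrow> a \<in> K \<Longrightarrow> b \<in> K \<Longrightarrow> (\<lambda>k. a k + b k) \<in> K"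
  by (simp add: subsp_def)

lemma subsp_scale: "subsp K \<Longrightarrow> a \<in> K \<Longrightarrow> (\<lambda>k. c * a k) \<in> K"
  by (simp add: subsp_def)

lemma subsp_diff:
  assumes "subsp K" "a \<in> K" "b \<in> K"
  shows "(\<lambda>k. a k - b k) \<in> K"
  using subsp_add[OF assms(1,2) subsp_scale[OF assms(1,3), of "-1"]] by simp

lemma parallelogram:
  assumes "a \<in> ell2" "b \<in> ell2"
  shows "nsq (\<lambda>k. a k - b k) + nsq (\<lambda>k. a k + b k) = 2 * nsq a + 2 * nsq b"
  using nsq_scale_diff[OF assms, of 1] nsq_scale_diff[OF assms, of "-1"] by simp

lemma nsq_scale: "nsq (\<lambda>k. c * a k) = (cmod c)\<^sup>2 * nsq a"
  unfolding nsq_def by (simp add: norm_mult power_mult_distrib infsum_cmult_right')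

text \<open>Subtracting the best multiple of \<open>h\<close> lowers the squared norm by
  \<open>(cmod (ip a h))^2 / nsq h\<close>; minimality forces this gain to be 0.\<close>

lemma min_orthogonal:
  assumes a: "a \<in> ell2" and h: "h \<in> ell2"
    and min: "\<And>c. nsq a \<le> nsq (\<lambda>k. a k - c * h k)"
  shows "ip a h = 0"
proof (cases "nsq h = 0")
  case True
  then have "h = (\<lambda>_. 0)" using ip_self_eq_0[OF h] by (simp add: ip_self)
  then show ?thesis by simp
next
  case False
  then have pos: "nsq h > 0" using nsq_nonneg[of h] by linarith
  have *: "Re (ip a h / nsq h * ip h a) = (cmod (ip a h))\<^sup>2 / nsq h"
    unfolding times_divide_eq_left ip_commute[of h a] complex_norm_square[symmetric]
    by (simp only: of_real_divide[symmetric] Re_complex_of_real)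
  have "nsq a \<le> nsq (\<lambda>k. a k - (ip a h / nsq h) * h k)" by (rule min)
  also have "\<dots> = nsq a - 2 * ((cmod (ip a h))\<^sup>2 / nsq h) + (cmod (ip a h))\<^sup>2 / (nsq h)\<^sup>2 * nsq h"
    unfolding nsq_scale_diff[OF a h] * by (simp add: norm_divide power_divide)
  also have "\<dots> = nsq a - (cmod (ip a h))\<^sup>2 / nsq h"
    using pos by (simp add: power2_eq_square)
  finally have "(cmod (ip a h))\<^sup>2 / nsq h \<le> 0" by simp
  then show ?thesis using pos by (simp add: divide_le_0_iff)
qed

text \<open>A minimising sequence is Cauchy by the parallelogram law. Its limit is taken
  coordinatewise, and the norm bounds pass to the limit through finite partial sums.\<close>

lemma projection_exists:
  assumes K: "closed_subsp K" and x: "x \<in> ell2"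
  shows "\<exists>g\<in>K. \<forall>h\<in>K. ip (\<lambda>k. x k - g k) h = 0"
proof -
  have sub: "subsp K" and Kl: "\<And>a. a \<in> K \<Longrightarrow> a \<in> ell2"
    using K unfolding closed_subsp_def subsp_def by auto
  define d where "d = (INF g\<in>K. nsq (\<lambda>k. x k - g k))"
  have bdd: "bdd_below ((\<lambda>g. nsq (\<lambda>k. x k - g k)) ` K)"
    by (auto intro!: bdd_belowI[where m = 0] nsq_nonneg)
  have ne: "K \<noteq> {}" using sub unfolding subsp_def by auto
  have d_le: "d \<le> nsq (\<lambda>k. x k - g k)" if "g \<in> K" for g
    unfolding d_def using that by (intro cINF_lower bdd)
  have "\<exists>g\<in>K. nsq (\<lambda>k. x k - g k) < d + 1 / Suc n" for n
  proof -
    have "(INF g\<in>K. nsq (\<lambda>k. x k - g k)) < d + 1 / Suc n"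
      unfolding d_def[symmetric] by simp
    then show ?thesis using cINF_less_iff[OF ne bdd] by blast
  qed
  then have "\<forall>n. \<exists>g. g \<in> K \<and> nsq (\<lambda>k. x k - g k) < d + 1 / Suc n" by blast
  from choice[OF this] obtain g
    where g0: "\<forall>n. g n \<in> K \<and> nsq (\<lambda>k. x k - g n k) < d + 1 / Suc n" ..
  have gK: "g n \<in> K" and g: "nsq (\<lambda>k. x k - g n k) < d + 1 / Suc n" for n
    using g0[THEN spec, of n] by simp_all
  have close: "nsq (\<lambda>k. g n k - g m k) \<le> 2 / Suc n + 2 / Suc m" for n m
  proof -
    \<comment> \<open>The midpoint of two members of \<open>K\<close> is again in \<open>K\<close>,
      hence at squared distance at least \<open>d\<close> from \<open>x\<close>.\<close>
    have mid: "(\<lambda>k. (1/2) * (g n k + g m k)) \<in> K"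
      by (intro subsp_scale[OF sub] subsp_add[OF sub] gK)
    have "nsq (\<lambda>k. (x k - g n k) - (x k - g m k)) + nsq (\<lambda>k. (x k - g n k) + (x k - g m k)) =
        2 * nsq (\<lambda>k. x k - g n k) + 2 * nsq (\<lambda>k. x k - g m k)"
      by (intro parallelogram ell2_diff x Kl gK)
    moreover have "(\<lambda>k. (x k - g n k) - (x k - g m k)) = (\<lambda>k. g m k - g n k)" by auto
    moreover have "nsq (\<lambda>k. g m k - g n k) = nsq (\<lambda>k. g n k - g m k)"
      by (simp add: nsq_def norm_minus_commute)
    moreover have "(\<lambda>k. (x k - g n k) + (x k - g m k)) = (\<lambda>k. 2 * (x k - (1/2) * (g n k + g m k)))"
      by (auto simp: algebra_simps)
    ultimately have "nsq (\<lambda>k. g n k - g m k) + 4 * nsq (\<lambda>k. x k - (1/2) * (g n k + g m k)) =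
        2 * nsq (\<lambda>k. x k - g n k) + 2 * nsq (\<lambda>k. x k - g m k)"
      by (simp only: nsq_scale) simp
    then show ?thesis using d_le[OF mid] g[of n] g[of m] by simp
  qed
  have "Cauchy (\<lambda>n. g n k)" for k
  proof (rule CauchyI)
    fix e :: real assume e: "e > 0"
    obtain M where M: "1 / Suc M < e\<^sup>2 / 4"
      using reals_Archimedean[of "e\<^sup>2 / 4"] e by (auto simp: inverse_eq_divide)
    have "norm (g m k - g n k) < e" if "m \<ge> M" "n \<ge> M" for m n
    proof -
      have "(\<Sum>k\<in>{k}. (cmod (g m k - g n k))\<^sup>2) \<le> nsq (\<lambda>k. g m k - g n k)"
        by (rule sum_le_nsq) (auto intro: Kl gK)
      also have "\<dots> \<le> 2 / Suc m + 2 / Suc n" by (rule close)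
      also have "\<dots> \<le> 2 / Suc M + 2 / Suc M"
        using that by (intro add_mono divide_left_mono) auto
      also have "\<dots> < e\<^sup>2" using M by simp
      finally show ?thesis using e by (simp add: power2_less_imp_less)
    qed
    then show "\<exists>M. \<forall>m\<ge>M. \<forall>n\<ge>M. norm (g m k - g n k) < e" by blast
  qed
  then have "\<exists>l. (\<lambda>n. g n k) \<longlonglongrightarrow> l" for k
    using Cauchy_convergent_iff convergent_def by blast
  then obtain y where y: "\<And>k. (\<lambda>n. g n k) \<longlonglongrightarrow> y k" by metis
  have inv0: "(\<lambda>n. c / real (Suc n)) \<longlonglongrightarrow> 0" for c
    using LIMSEQ_Suc[OF lim_const_over_n[of c]] by simp
  have lim_d: "(\<lambda>n. d + 1 / Suc n) \<longlonglongrightarrow> d"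
    using tendsto_add[OF tendsto_const inv0, of d 1] by simp
  have bd: "(\<Sum>k\<in>F. (cmod (x k - y k))\<^sup>2) \<le> d" if "finite F" for F
  proof (rule LIMSEQ_le)
    show "(\<lambda>n. \<Sum>k\<in>F. (cmod (x k - g n k))\<^sup>2) \<longlonglongrightarrow> (\<Sum>k\<in>F. (cmod (x k - y k))\<^sup>2)"
      by (intro tendsto_intros y)
    have "(\<Sum>k\<in>F. (cmod (x k - g n k))\<^sup>2) \<le> d + 1 / Suc n" for n
      using sum_le_nsq[OF ell2_diff[OF x Kl[OF gK[of n]]] that] g[of n] by linarith
    then show "\<exists>N. \<forall>n\<ge>N. (\<Sum>k\<in>F. (cmod (x k - g n k))\<^sup>2) \<le> d + 1 / Suc n" by blast
  qed (rule lim_d)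
  have xy: "(\<lambda>k. x k - y k) \<in> ell2" and nxy: "nsq (\<lambda>k. x k - y k) \<le> d"
    using ell2_bound[of "\<lambda>k. x k - y k" d] bd by auto
  have yl: "y \<in> ell2" using ell2_diff[OF x xy] by simp
  have near: "nsq (\<lambda>k. y k - g m k) \<le> 2 / Suc m" for m
  proof (rule ell2_bound)
    fix F :: "'a set" assume F: "finite F"
    show "(\<Sum>k\<in>F. (cmod (y k - g m k))\<^sup>2) \<le> 2 / Suc m"
    proof (rule LIMSEQ_le)
      show "(\<lambda>n. \<Sum>k\<in>F. (cmod (g n k - g m k))\<^sup>2) \<longlonglongrightarrow> (\<Sum>k\<in>F. (cmod (y k - g m k))\<^sup>2)"
        by (intro tendsto_intros y)
      have "(\<Sum>k\<in>F. (cmod (g n k - g m k))\<^sup>2) \<le> 2 / Suc n + 2 / Suc m" for n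
        using sum_le_nsq[OF ell2_diff[OF Kl[OF gK[of n]] Kl[OF gK[of m]]] F] close[of n m] by linarith
      then show "\<exists>N. \<forall>n\<ge>N. (\<Sum>k\<in>F. (cmod (g n k - g m k))\<^sup>2) \<le> 2 / Suc n + 2 / Suc m" by blast
      show "(\<lambda>n. 2 / Suc n + 2 / Suc m) \<longlonglongrightarrow> 2 / Suc m"
        using tendsto_add[OF inv0 tendsto_const, of 2 "2 / Suc m"] by simp
    qed
  qed
  have "y \<in> K"
  proof -
    have "\<exists>g\<in>K. nsq (\<lambda>k. y k - g k) < e" if "e > 0" for e
    proof -
      obtain m where "1 / Suc m < e / 2"
        using reals_Archimedean[of "e / 2"] \<open>e > 0\<close> by (auto simp: inverse_eq_divide)
      then have "nsq (\<lambda>k. y k - g m k) < e" using near[of m] by simp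
      then show ?thesis using gK by blast
    qed
    then show ?thesis using K yl unfolding closed_subsp_def by blast
  qed
  moreover have "ip (\<lambda>k. x k - y k) h = 0" if h: "h \<in> K" for h
  proof (rule min_orthogonal[OF xy Kl[OF h]])
    \<comment> \<open>Moving from \<open>y\<close> by a multiple of \<open>h\<close> stays in
      \<open>K\<close>, so it cannot bring the squared distance below \<open>d\<close>.\<close>
    fix c
    have "(\<lambda>k. y k + c * h k) \<in> K"
      by (intro subsp_scale[OF sub] subsp_add[OF sub] h \<open>y \<in> K\<close>)
    from d_le[OF this] nxy show "nsq (\<lambda>k. x k - y k) \<le> nsq (\<lambda>k. x k - y k - c * h k)"
      by (simp add: diff_diff_eq)
  qed
  ultimately show ?thesis by blast
qed

text \<open>If \<open>g\<close> is orthogonal to \<open>b\<close>, then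
  \<open>ip a b = ip (a - g) b\<close>, which is small by Cauchy-Schwarz.\<close>

lemma ip_closure:
  assumes "a \<in> ell2" "b \<in> ell2" "\<And>e. e > 0 \<Longrightarrow> \<exists>g\<in>ell2. ip g b = 0 \<and> nsq (\<lambda>k. a k - g k) < e"
  shows "ip a b = 0"
proof (rule ccontr)
  assume ne: "ip a b \<noteq> 0"
  \<comment> \<open>The summand 1 keeps the denominator positive and makes the final comparison
    strict.\<close>
  define e where "e = (cmod (ip a b))\<^sup>2 / (nsq b + 1)"
  have pos: "nsq b + 1 > 0" using nsq_nonneg[of b] by linarith
  have "e > 0" unfolding e_def using ne pos by simp
  then obtain g where g: "g \<in> ell2" "ip g b = 0" "nsq (\<lambda>k. a k - g k) < e"
    using assms(3) by blast
  have "(cmod (ip a b))\<^sup>2 = (cmod (ip (\<lambda>k. a k - g k) b))\<^sup>2"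
    using assms g by (simp add: ip_diff_left)
  also have "\<dots> \<le> nsq (\<lambda>k. a k - g k) * nsq b"
    using assms g by (intro cauchy_schwarz) auto
  also have "\<dots> \<le> e * nsq b"
    using g nsq_nonneg[of b] by (intro mult_right_mono) auto
  also have "\<dots> < e * (nsq b + 1)" using \<open>e > 0\<close> by simp
  also have "\<dots> = (cmod (ip a b))\<^sup>2" unfolding e_def using pos by simp
  finally show False by simp
qed

lemma closed_subsp_orth:
  assumes "A \<subseteq> ell2"
  shows "closed_subsp {a \<in> ell2. \<forall>g\<in>A. ip a g = 0}"
  unfolding closed_subsp_def subsp_def
proof (intro conjI ballI impI allI)
  fix a :: "'a \<Rightarrow> complex" assume a: "a \<in> ell2"
    and cl: "\<forall>e>0. \<exists>g\<in>{a \<in> ell2. \<forall>g\<in>A. ip a g = 0}. nsq (\<lambda>k. a k - g k) < e"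
  have "ip a g = 0" if "g \<in> A" for g
    by (rule ip_closure) (use a cl that assms in blast)+
  then show "a \<in> {a \<in> ell2. \<forall>g\<in>A. ip a g = 0}" using a by blast
qed (use assms in \<open>auto simp: ip_add_left ip_scale_left subset_iff\<close>)

section \<open>Shifts of double sequences\<close>

text \<open>Here \<open>g\<close> is \<open>a\<close> transported along \<open>f\<close> and
  extended by 0; this transport is adjoint to composition with \<open>f\<close>. Both forward shifts
  are instances.\<close>

lemma ip_push:
  assumes "inj f" "\<And>k. g (f k) = a k" "\<And>k. k \<notin> range f \<Longrightarrow> g k = 0"
  shows "ip g b = ip a (\<lambda>k. b (f k))"
proof -
  have "ip g b = (\<Sum>\<^sub>\<infinity>k\<in>range f. g k * cnj (b k))"
    unfolding ip_def by (rule infsum_cong_neutral) (auto simp: assms(3))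
  also have "\<dots> = ip a (\<lambda>k. b (f k))"
    unfolding ip_def by (subst infsum_reindex) (auto simp: assms o_def)
  finally show ?thesis .
qed

lemma ell2_push:
  assumes "inj f" "\<And>k. g (f k) = a k" "\<And>k. k \<notin> range f \<Longrightarrow> g k = 0" "a \<in> ell2"
  shows "g \<in> ell2"
proof -
  have "(\<lambda>k. (cmod (g k))\<^sup>2) summable_on range f"
    using assms(4) summable_on_reindex[OF assms(1), of "\<lambda>k. (cmod (g k))\<^sup>2"]
    by (simp add: o_def assms(2) ell2_def)
  then show ?thesis
    unfolding ell2_def mem_Collect_eq
    by (rule summable_on_cong_neutral[THEN iffD1, rotated -1]) (auto simp: assms(3))
qed

type_synonym coeffs = "nat \<times> nat \<Rightarrow> complex"

definition mulz :: "coeffs \<Rightarrow> coeffs" where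
  "mulz a = (\<lambda>(i, j). case i of 0 \<Rightarrow> 0 | Suc i' \<Rightarrow> a (i', j))"

definition mulw :: "coeffs \<Rightarrow> coeffs" where
  "mulw a = (\<lambda>(i, j). case j of 0 \<Rightarrow> 0 | Suc j' \<Rightarrow> a (i, j'))"

text \<open>This is the operator \<open>L\<close> of the overview; \<open>backd\<close> below is its
  \<open>D\<close>.\<close>

definition backz :: "coeffs \<Rightarrow> coeffs" where
  "backz a = (\<lambda>(i, j). a (Suc i, j))"

definition backw :: "coeffs \<Rightarrow> coeffs" where
  "backw a = (\<lambda>(i, j). a (i, Suc j))"

definition muld :: "coeffs \<Rightarrow> coeffs" where
  "muld a = (\<lambda>k. mulz a k - mulw a k)"

definition backd :: "coeffs \<Rightarrow> coeffs" where
  "backd a = (\<lambda>k. backz a k - backw a k)"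

lemma backd_apply: "backd a (i, j) = a (Suc i, j) - a (i, Suc j)"
  by (simp add: backd_def backz_def backw_def)

lemma muld_apply:
  "muld a (i, j) =
     (case i of 0 \<Rightarrow> 0 | Suc i' \<Rightarrow> a (i', j)) - (case j of 0 \<Rightarrow> 0 | Suc j' \<Rightarrow> a (i, j'))"
  by (simp add: muld_def mulz_def mulw_def)

lemma inj_sucs: "inj (\<lambda>(i, j). (Suc i, j))" "inj (\<lambda>(i, j). (i, Suc j))"
  by (auto simp: inj_on_def)

lemma ip_mulz: "ip (mulz a) b = ip a (backz b)"
  unfolding backz_def case_prod_beta
  by (rule ip_push[OF inj_sucs(1), unfolded case_prod_beta])
     (auto simp: mulz_def image_iff split: nat.splits)

lemma ip_mulw: "ip (mulw a) b = ip a (backw b)"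
  unfolding backw_def case_prod_beta
  by (rule ip_push[OF inj_sucs(2), unfolded case_prod_beta])
     (auto simp: mulw_def image_iff split: nat.splits)

lemma ell2_mulz [intro]: "a \<in> ell2 \<Longrightarrow> mulz a \<in> ell2"
  by (rule ell2_push[OF inj_sucs(1)]) (auto simp: mulz_def image_iff split: nat.splits)

lemma ell2_mulw [intro]: "a \<in> ell2 \<Longrightarrow> mulw a \<in> ell2"
  by (rule ell2_push[OF inj_sucs(2)]) (auto simp: mulw_def image_iff split: nat.splits)

lemma ell2_backz [intro]: "a \<in> ell2 \<Longrightarrow> backz a \<in> ell2"
  using ell2_compose[OF _ inj_sucs(1), of a] by (simp add: backz_def case_prod_unfold)

lemma ell2_backw [intro]: "a \<in> ell2 \<Longrightarrow> backw a \<in> ell2"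
  using ell2_compose[OF _ inj_sucs(2), of a] by (simp add: backw_def case_prod_unfold)

lemma ell2_muld [intro]: "a \<in> ell2 \<Longrightarrow> muld a \<in> ell2"
  unfolding muld_def by auto

lemma ell2_backd [intro]: "a \<in> ell2 \<Longrightarrow> backd a \<in> ell2"
  unfolding backd_def by auto

lemma ell2_muld_pow [intro]: "a \<in> ell2 \<Longrightarrow> (muld ^^ n) a \<in> ell2"
  by (induction n) auto

lemma ip_muld:
  assumes "a \<in> ell2" "b \<in> ell2"
  shows "ip (muld a) b = ip a (backd b)"
  using assms unfolding muld_def backd_def
  by (simp add: ip_diff_left ip_diff_right ell2_mulz ell2_mulw ell2_backz ell2_backw ip_mulz ip_mulw)

lemma ip_muld_pow:
  assumes "a \<in> ell2" "b \<in> ell2"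
  shows "ip ((muld ^^ n) a) b = ip a ((backd ^^ n) b)"
  using assms(2)
proof (induction n arbitrary: b)
  case (Suc n)
  have "ip ((muld ^^ Suc n) a) b = ip ((muld ^^ n) a) (backd b)"
    using ip_muld[OF ell2_muld_pow[OF assms(1)] Suc.prems] by simp
  also have "\<dots> = ip a ((backd ^^ Suc n) b)"
    using Suc.IH[OF ell2_backd[OF Suc.prems]] by (simp add: funpow_swap1)
  finally show ?case .
qed simp

lemma backz_linear:
  "backz (\<lambda>k. a k + b k) = (\<lambda>k. backz a k + backz b k)"
  "backz (\<lambda>k. a k - b k) = (\<lambda>k. backz a k - backz b k)"
  "backz (\<lambda>k. c * a k) = (\<lambda>k. c * backz a k)"
  "backz (\<lambda>k. 0) = (\<lambda>k. 0)"
  by (auto simp: backz_def)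

lemma backd_pow_linear:
  "(backd ^^ n) (\<lambda>k. a k + b k) = (\<lambda>k. (backd ^^ n) a k + (backd ^^ n) b k)"
  "(backd ^^ n) (\<lambda>k. a k - b k) = (\<lambda>k. (backd ^^ n) a k - (backd ^^ n) b k)"
  "(backd ^^ n) (\<lambda>k. c * a k) = (\<lambda>k. c * (backd ^^ n) a k)"
  "(backd ^^ n) (\<lambda>k. 0) = (\<lambda>k. 0)"
  by (induction n; auto simp: backd_def backz_def backw_def fun_eq_iff algebra_simps)+

lemma backd_pow_backz: "(backd ^^ n) (backz a) = backz ((backd ^^ n) a)"
  by (induction n) (auto simp: backd_def backz_def backw_def fun_eq_iff)

lemma backz_pow_apply: "(backz ^^ n) a (i, j) = a (i + n, j)"
  by (induction n arbitrary: i) (auto simp: backz_def)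

text \<open>Each application of \<open>backd\<close> lowers the total degree by one, so the degree
  \<open>m\<close> part of the result depends only on the degree \<open>m + n\<close> part of the
  input. Most uses take one side to be 0.\<close>

lemma backd_pow_local:
  assumes "\<And>i j. i + j = m + n \<Longrightarrow> a (i, j) = b (i, j)" "i + j = m"
  shows "(backd ^^ n) a (i, j) = (backd ^^ n) b (i, j)"
  using assms
proof (induction n arbitrary: m i j)
  case (Suc n)
  have "(backd ^^ n) a (i', j') = (backd ^^ n) b (i', j')" if "i' + j' = Suc m" for i' j'
    by (rule Suc.IH[of "Suc m"]) (use Suc.prems that in auto)
  then show ?case using Suc.prems(2) by (simp add: backd_apply)
qed simp

definition deltac :: "nat \<times> nat \<Rightarrow> coeffs" where
  "deltac k0 = (\<lambda>k. if k = k0 then 1 else 0)"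

lemma ell2_deltac [simp, intro]: "deltac k0 \<in> ell2"
  by (rule ell2_finite_support) (auto simp: deltac_def)

lemma ip_deltac: "ip a (deltac k0) = a k0" "ip (deltac k0) a = cnj (a k0)"
  by (subst ip_single[of k0], auto simp: deltac_def)+

text \<open>The coefficients of \<open>(z - w)^n\<close>, built by multiplying the constant 1
  repeatedly by \<open>z - w\<close>.\<close>

definition diffpow :: "nat \<Rightarrow> coeffs" where
  "diffpow n = (muld ^^ n) (deltac (0, 0))"

lemma ell2_diffpow [intro]: "diffpow n \<in> ell2"
  unfolding diffpow_def by auto

text \<open>The induction step is Pascal's rule. All coefficients in degree \<open>n\<close> turn
  out to be nonzero.\<close>

lemma diffpow_eq:
  "diffpow n (i, j) = (if i + j = n then (-1) ^ j * of_nat (n choose j) else 0)"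
proof (induction n arbitrary: i j)
  case 0
  show ?case by (auto simp: diffpow_def deltac_def)
next
  case (Suc n)
  have "diffpow (Suc n) = muld (diffpow n)"
    by (simp add: diffpow_def)
  then show ?case
    by (cases i; cases j) (auto simp: muld_apply Suc.IH algebra_simps)
qed

text \<open>Moving the \<open>n\<close> factors \<open>z - w\<close> across the inner product leaves
  a pairing with 1. Thus in degree \<open>n\<close> membership in \<open>kerd n\<close> is a single
  condition: orthogonality to \<open>(z - w)^n\<close>.\<close>

lemma ip_diffpow: "a \<in> ell2 \<Longrightarrow> ip a (diffpow n) = (backd ^^ n) a (0, 0)"
  unfolding diffpow_def ip_commute[of a]
  by (subst ip_muld_pow) (auto simp: ip_deltac)

section \<open>The kernel of \<open>D^n\<close>\<close>

definition kerd :: "nat \<Rightarrow> coeffs set" where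
  "kerd n = {a \<in> ell2. (backd ^^ n) a = (\<lambda>_. 0)}"

lemma kerd_ell2: "a \<in> kerd n \<Longrightarrow> a \<in> ell2"
  by (simp add: kerd_def)

lemma subsp_kerd: "subsp (kerd n)"
  unfolding subsp_def kerd_def by (auto simp: backd_pow_linear)

lemma backz_kerd: "a \<in> kerd n \<Longrightarrow> backz a \<in> kerd n"
  by (auto simp: kerd_def backd_pow_backz backz_linear)

lemma ip_diffpow_kerd: "a \<in> kerd n \<Longrightarrow> ip a (diffpow n) = 0"
  by (simp add: kerd_def ip_diffpow)

text \<open>By locality, each entry of \<open>D^n\<close> applied to the truncation is either the
  entry for \<open>a\<close> or the entry for 0.\<close>

lemma kerd_homogeneous:
  assumes "a \<in> kerd n"
  shows "(\<lambda>k. if fst k + snd k = m then a k else 0) \<in> kerd n"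
proof -
  have "(backd ^^ n) (\<lambda>k. if fst k + snd k = m then a k else 0) (i, j) = 0" for i j
  proof (cases "i + j + n = m")
    case True
    have "(backd ^^ n) (\<lambda>k. if fst k + snd k = m then a k else 0) (i, j) = (backd ^^ n) a (i, j)"
      by (rule backd_pow_local[of "i + j"]) (use True in auto)
    then show ?thesis using assms by (simp add: kerd_def)
  next
    case False
    have "(backd ^^ n) (\<lambda>k. if fst k + snd k = m then a k else 0) (i, j) = (backd ^^ n) (\<lambda>_. 0) (i, j)"
      by (rule backd_pow_local[of "i + j"]) (use False in auto)
    then show ?thesis by (simp add: backd_pow_linear)
  qed
  then show ?thesis using assms by (auto simp: kerd_def)
qed

text \<open>When \<open>L a = 0\<close>, only powers of \<open>w\<close> occur in \<open>a\<close>,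
  and on these \<open>D\<close> is minus the backward shift in \<open>w\<close>. Hence
  \<open>D^n a = 0\<close> removes the powers from \<open>w^n\<close> on.\<close>

lemma kerd_backz_zero:
  assumes "a \<in> kerd n" "backz a = (\<lambda>_. 0)"
  shows "i > 0 \<Longrightarrow> a (i, j) = 0" "j \<ge> n \<Longrightarrow> a (i, j) = 0"
proof -
  have z: "a (Suc i, j) = 0" for i j
    using assms(2) by (auto simp: backz_def dest: fun_cong[of _ _ "(i, j)"])
  then show 1: "i > 0 \<Longrightarrow> a (i, j) = 0" for i j by (cases i) auto
  have *: "(backd ^^ m) a (i, j) = (-1) ^ m * a (i, j + m)" for m i j
    by (induction m arbitrary: i j) (auto simp: backd_def backz_def backw_def z)
  show "j \<ge> n \<Longrightarrow> a (i, j) = 0"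
    using *[of n i "j - n"] assms(1) by (simp add: kerd_def)
qed

section \<open>Reducing subspaces in terms of coefficients\<close>

text \<open>The last clause is invariance under \<open>S_z\<close>: its hypothesis says that
  \<open>g\<close> is the orthogonal projection of \<open>mulz a\<close> onto \<open>kerd n\<close>.
  Invariance under the adjoint is invariance under \<open>backz\<close>.\<close>

definition reducing :: "nat \<Rightarrow> coeffs set \<Rightarrow> bool" where
  "reducing n K \<longleftrightarrow> subsp K \<and> K \<subseteq> kerd n \<and> (\<forall>a\<in>K. backz a \<in> K) \<and>
     (\<forall>a\<in>K. \<forall>g\<in>kerd n. (\<forall>h\<in>kerd n. ip (\<lambda>k. mulz a k - g k) h = 0) \<longrightarrow> g \<in> K)"

definition complementary :: "nat \<Rightarrow> coeffs set \<Rightarrow> coeffs set \<Rightarrow> bool" where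
  "complementary n K K' \<longleftrightarrow> reducing n K \<and> reducing n K' \<and> (\<forall>a\<in>K. \<forall>b\<in>K'. ip a b = 0) \<and>
     (\<forall>x\<in>kerd n. \<exists>a\<in>K. \<exists>b\<in>K'. x = (\<lambda>k. a k + b k))"

lemma complementary_sym: "complementary n K K' \<Longrightarrow> complementary n K' K"
  unfolding complementary_def
  by (metis (no_types, lifting) add.commute complex_cnj_zero ip_commute)

text \<open>Since \<open>L (z a) = a\<close> and \<open>S_z a = z a - t (z - w)^n\<close>, the
  vector \<open>a - L (S_z a)\<close> of \<open>K\<close> equals \<open>t u\<close> with
  \<open>u = L ((z - w)^n)\<close>, and \<open>t\<close> is nonzero because of the
  \<open>w^(n-1)\<close>-coefficient of \<open>a\<close>.\<close>

lemma reducing_diffpow: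
  assumes K: "reducing n K" and a: "a \<in> K" "backz a = (\<lambda>_. 0)"
    and a_top: "a (0, n - 1) \<noteq> 0" and n: "n \<ge> 1"
  shows "backz (diffpow n) \<in> K"
proof -
  define c where "c = a (0, n - 1)"
  define s where "s = ip (diffpow n) (diffpow n)"
  \<comment> \<open>The numerator is the inner product of \<open>z a\<close> with
    \<open>(z - w)^n\<close>: the only monomial they share is \<open>z w^(n-1)\<close>. Hence
    \<open>g\<close> below is orthogonal to \<open>(z - w)^n\<close>.\<close>
  define t where "t = c * of_int ((-1) ^ (n - 1) * int n) / s"
  define g where "g = (\<lambda>k. mulz a k - t * diffpow n k)"
  \<comment> \<open>\<open>z a\<close> has degree at most \<open>n\<close>, and in degree \<open>n\<close> the multiples of \<open>(z - w)\<^sup>n\<close> are all of the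
    orthogonal complement of \<open>kerd n\<close>; hence \<open>g\<close> is the projection of \<open>z a\<close>.\<close>
  have aN: "a \<in> kerd n" and sub: "subsp K" using K a(1) unfolding reducing_def by auto
  have al: "a \<in> ell2" using aN by (rule kerd_ell2)
  note az = kerd_backz_zero[OF aN a(2)]
  have s0: "s \<noteq> 0"
  proof
    assume "s = 0"
    then have "diffpow n = (\<lambda>_. 0)" unfolding s_def by (intro ip_self_eq_0 ell2_diffpow)
    then have "diffpow n (n, 0) = 0" by simp
    then show False by (simp add: diffpow_eq)
  qed
  have t0: "t \<noteq> 0" using s0 n a_top by (simp add: t_def c_def)
  have gl: "g \<in> ell2" unfolding g_def by (intro ell2_diff ell2_scale ell2_mulz ell2_diffpow al)
  have mz: "mulz a (i, j) = (if i = 1 \<and> j < n then a (0, j) else 0)" for i j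
    using az[of "i - 1" j] az(2)[of j "i - 1"] by (auto simp: mulz_def split: nat.splits)
  have ipm: "ip (mulz a) (diffpow n) = t * s"
  proof -
    have "ip (mulz a) (diffpow n) = mulz a (1, n - 1) * cnj (diffpow n (1, n - 1))"
      by (rule ip_single) (auto simp: mz diffpow_eq split: if_splits)
    also have "\<dots> = c * of_int ((-1) ^ (n - 1) * int n)"
      using n binomial_symmetric[of 1 n] by (simp add: mz diffpow_eq c_def)
    finally show ?thesis using s0 by (simp add: t_def)
  qed
  \<comment> \<open>The entry at \<open>(0, 0)\<close> is the pairing with \<open>(z - w)^n\<close>;
    the other entries only see degrees above \<open>n\<close>, where \<open>g\<close> has no
    terms.\<close>
  have "(backd ^^ n) g (i, j) = 0" for i j
  proof (cases "i + j = 0")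
    case True
    have "ip g (diffpow n) = ip (mulz a) (diffpow n) - t * s"
      unfolding g_def s_def using al by (subst ip_diff_left) (auto simp: ip_scale_left)
    then show ?thesis using True ip_diffpow[OF gl] ipm by simp
  next
    case False
    have "(backd ^^ n) g (i, j) = (backd ^^ n) (\<lambda>_. 0) (i, j)"
      by (rule backd_pow_local[of "i + j"]) (use False in \<open>auto simp: g_def mz diffpow_eq\<close>)
    then show ?thesis by (simp add: backd_pow_linear)
  qed
  then have gN: "g \<in> kerd n" using gl by (auto simp: kerd_def)
  have "ip (\<lambda>k. mulz a k - g k) h = 0" if "h \<in> kerd n" for h
    using ip_diffpow_kerd[OF that] ip_commute[of "diffpow n" h]
    by (simp add: g_def ip_scale_left)
  then have "g \<in> K" using K a(1) gN unfolding reducing_def by blast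
  then have "(\<lambda>k. a k - backz g k) \<in> K"
    using K a(1) subsp_diff[OF sub] unfolding reducing_def by blast
  from subsp_scale[OF sub this, of "1 / t"]
  have "(\<lambda>k. 1 / t * (a k - backz g k)) \<in> K" .
  moreover have "(\<lambda>k. 1 / t * (a k - backz g k)) = backz (diffpow n)"
    using t0 by (auto simp: g_def backz_def mulz_def)
  ultimately show ?thesis by simp
qed

text \<open>First \<open>K\<close> is shown to contain no nonzero vector killed by \<open>L\<close>,
  then none killed by a power of \<open>L\<close>. This puts every homogeneous part of a vector of
  \<open>K\<close> into \<open>K'\<close>, so all these parts vanish.\<close>

lemma complementary_trivial:
  assumes c: "complementary n K K'" and d: "backz (diffpow n) \<in> K'"
  shows "K = {\<lambda>_. 0}"
proof -
  have K: "reducing n K" "reducing n K'" and orth: "\<And>a b. a \<in> K \<Longrightarrow> b \<in> K' \<Longrightarrow> ip a b = 0"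
    and dec: "\<And>x. x \<in> kerd n \<Longrightarrow> \<exists>a\<in>K. \<exists>b\<in>K'. x = (\<lambda>k. a k + b k)"
    using c unfolding complementary_def by blast+
  have sub: "subsp K" "subsp K'" and KN: "K \<subseteq> kerd n"
    and bz: "\<And>a. a \<in> K \<Longrightarrow> backz a \<in> K" "\<And>a. a \<in> K' \<Longrightarrow> backz a \<in> K'"
    using K unfolding reducing_def by blast+
  have pow: "(backz ^^ k) (backz (diffpow n)) \<in> K'" for k
    by (induction k) (use d bz in auto)
  have zero: "a = (\<lambda>_. 0)" if a: "a \<in> K" "backz a = (\<lambda>_. 0)" for a
  proof -
    note az = kerd_backz_zero[OF subsetD[OF KN a(1)] a(2)]
    have "a (i, j) = 0" for i j
    proof (cases "i > 0 \<or> j \<ge> n")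
      case False
      \<comment> \<open>As \<open>u\<close> already contains one \<open>L\<close>, this is
        \<open>L^(n-j)\<close> applied to \<open>(z - w)^n\<close>. It is homogeneous of degree
        \<open>j\<close>, so it meets the \<open>w\<close>-polynomial \<open>a\<close> only in
        \<open>w^j\<close>, where its coefficient is nonzero.\<close>
      let ?b = "(backz ^^ (n - Suc j)) (backz (diffpow n))"
      have b: "?b (i, j') = diffpow n (i + (n - j), j')" for i j'
        using False by (simp add: backz_pow_apply backz_def Suc_diff_Suc del: funpow.simps)
      have "ip a ?b = a (0, j) * cnj (?b (0, j))"
      proof (rule ip_single)
        fix k :: "nat \<times> nat" assume "k \<noteq> (0, j)"
        then show "a k * cnj (?b k) = 0"
          using az(1)[of "fst k" "snd k"] False b[of "fst k" "snd k"]
          by (cases k) (auto simp: diffpow_eq)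
      qed
      also have "?b (0, j) = (-1) ^ j * of_nat (n choose j)"
        using False by (simp add: b diffpow_eq)
      finally show ?thesis using orth[OF a(1) pow[of "n - Suc j"]] False by auto
    qed (use az in auto)
    then show ?thesis by auto
  qed
  have zero_pow: "a = (\<lambda>_. 0)" if "a \<in> K" "(backz ^^ m) a = (\<lambda>_. 0)" for a m
    using that
  proof (induction m arbitrary: a)
    case (Suc m)
    have "backz a = (\<lambda>_. 0)"
      by (rule Suc.IH) (use Suc.prems bz in \<open>auto simp: funpow_swap1\<close>)
    with Suc.prems(1) show ?case by (rule zero)
  qed simp
  have "f = (\<lambda>_. 0)" if f: "f \<in> K" for f
  proof -
    have "f (i, j) = 0" for i j
    proof -
      \<comment> \<open>The homogeneous part of \<open>f\<close> of degree \<open>i + j\<close> is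
        only known to lie in \<open>kerd n\<close>, so it is split between \<open>K\<close> and
        \<open>K'\<close>.\<close>
      let ?f = "\<lambda>k. if fst k + snd k = i + j then f k else 0"
      have fN: "?f \<in> kerd n" using f KN by (intro kerd_homogeneous) auto
      obtain a b where ab: "a \<in> K" "b \<in> K'" "?f = (\<lambda>k. a k + b k)" using dec[OF fN] by blast
      define m where "m = Suc (i + j)"
      have "(backz ^^ m) ?f = (\<lambda>_. 0)"
        by (auto simp: backz_pow_apply fun_eq_iff m_def simp del: funpow.simps)
      then have s: "(backz ^^ m) a k + (backz ^^ m) b k = 0" for k
        unfolding ab(3) by (cases k) (auto simp: backz_pow_apply fun_eq_iff)
      have powK: "(backz ^^ m) a \<in> K" "(backz ^^ m) b \<in> K'"
        using ab bz by (induction m) auto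
      \<comment> \<open>A polynomial of degree \<open>i + j\<close> is killed by \<open>L^m\<close>.
        So \<open>L^m a\<close> is minus \<open>L^m b\<close>, which lies in \<open>K'\<close>;
        being also in \<open>K\<close>, it is orthogonal to itself.\<close>
      have "(backz ^^ m) b = (\<lambda>k. (-1) * (backz ^^ m) a k)"
        using s by (auto simp: fun_eq_iff add_eq_0_iff)
      then have "ip ((backz ^^ m) a) ((backz ^^ m) a) = 0"
        using orth[OF powK] ip_scale_right[of "(backz ^^ m) a" "-1" "(backz ^^ m) a"] by simp
      then have "(backz ^^ m) a = (\<lambda>_. 0)"
        using powK(1) KN kerd_ell2 by (intro ip_self_eq_0) auto
      with ab(1) have "a = (\<lambda>_. 0)" by (rule zero_pow)
      then have "?f \<in> K'" using ab(2,3) by simp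
      then have "ip f ?f = 0" using orth f by blast
      \<comment> \<open>Outside the support of \<open>?f\<close> both summands are 0, so the pairing
        with \<open>f\<close> is the squared norm of \<open>?f\<close>.\<close>
      moreover have "ip ?f ?f = ip f ?f"
        unfolding ip_def by (rule infsum_cong) auto
      ultimately have "?f = (\<lambda>_. 0)" using fN kerd_ell2 by (intro ip_self_eq_0) auto
      from fun_cong[OF this, of "(i, j)"] show ?thesis by simp
    qed
    then show ?thesis by auto
  qed
  then show ?thesis using sub(1) unfolding subsp_def by blast
qed

text \<open>Splitting \<open>w^(n-1)\<close> decides which of the two subspaces contains
  \<open>u\<close>; the other one is then trivial.\<close>

lemma complementary_cases:
  assumes c: "complementary n K K'" and n: "n \<ge> 1"
  shows "K = {\<lambda>_. 0} \<or> K' = {\<lambda>_. 0}"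
proof -
  have K: "reducing n K" "reducing n K'" and orth: "\<And>a b. a \<in> K \<Longrightarrow> b \<in> K' \<Longrightarrow> ip a b = 0"
    and dec: "\<And>x. x \<in> kerd n \<Longrightarrow> \<exists>a\<in>K. \<exists>b\<in>K'. x = (\<lambda>k. a k + b k)"
    using c unfolding complementary_def by blast+
  have KN: "K \<subseteq> kerd n" "K' \<subseteq> kerd n"
    and bz: "\<And>a. a \<in> K \<Longrightarrow> backz a \<in> K" "\<And>a. a \<in> K' \<Longrightarrow> backz a \<in> K'"
    using K unfolding reducing_def by blast+
  \<comment> \<open>\<open>D^n\<close> sees only degrees at least \<open>n\<close>, and
    \<open>w^(n-1)\<close> has degree \<open>n - 1\<close>.\<close>
  have "(backd ^^ n) (deltac (0, n - 1)) (i, j) = (backd ^^ n) (\<lambda>_. 0) (i, j)" for i j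
    by (rule backd_pow_local[of "i + j"]) (use n in \<open>auto simp: deltac_def\<close>)
  then have "deltac (0, n - 1) \<in> kerd n"
    by (auto simp: kerd_def backd_pow_linear)
  then obtain a b where ab: "a \<in> K" "b \<in> K'" "deltac (0, n - 1) = (\<lambda>k. a k + b k)"
    using dec by blast
  have "backz (deltac (0, n - 1)) = (\<lambda>_. 0)" by (auto simp: backz_def deltac_def)
  then have s: "backz a k + backz b k = 0" for k
    unfolding ab(3) by (cases k) (simp add: backz_linear fun_eq_iff)
  \<comment> \<open>As \<open>L\<close> kills \<open>w^(n-1)\<close>, the images of the two
    components under \<open>L\<close> cancel; they lie in orthogonal subspaces, so both are
    0.\<close>
  have eq: "backz b = (\<lambda>k. (-1) * backz a k)"
    using s by (auto simp: fun_eq_iff add_eq_0_iff)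
  then have "ip (backz a) (backz a) = 0"
    using orth[OF bz(1)[OF ab(1)] bz(2)[OF ab(2)]] ip_scale_right[of "backz a" "-1" "backz a"] by simp
  then have a0: "backz a = (\<lambda>_. 0)"
    using bz(1)[OF ab(1)] KN kerd_ell2 by (intro ip_self_eq_0) auto
  then have b0: "backz b = (\<lambda>_. 0)" using eq by simp
  have "a (0, n - 1) + b (0, n - 1) = 1"
    using fun_cong[OF ab(3), of "(0, n - 1)"] by (simp add: deltac_def)
  then consider "a (0, n - 1) \<noteq> 0" | "b (0, n - 1) \<noteq> 0" by force
  then show ?thesis
  proof cases
    case 1
    from reducing_diffpow[OF K(1) ab(1) a0 this n] complementary_trivial[OF complementary_sym[OF c]]
    show ?thesis by blast
  next
    case 2
    from reducing_diffpow[OF K(2) ab(2) b0 this n] complementary_trivial[OF c]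
    show ?thesis by blast
  qed
qed

text \<open>The orthogonal complement of \<open>K\<close> in \<open>kerd n\<close> is reducing as
  well, because adjointness exchanges the two invariance conditions.\<close>

lemma reducing_kerd_trivial:
  assumes K: "reducing n K" and cl: "closed_subsp K" and clN: "closed_subsp (kerd n)" and n: "n \<ge> 1"
  shows "K = {\<lambda>_. 0} \<or> K = kerd n"
proof -
  have sub: "subsp K" and KN: "K \<subseteq> kerd n" and bz: "\<And>a. a \<in> K \<Longrightarrow> backz a \<in> K"
    and fz: "\<And>a g. a \<in> K \<Longrightarrow> g \<in> kerd n \<Longrightarrow> (\<And>h. h \<in> kerd n \<Longrightarrow> ip (\<lambda>k. mulz a k - g k) h = 0) \<Longrightarrow> g \<in> K"
    using K unfolding reducing_def by blast+
  note Nl = kerd_ell2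
  define K' where "K' = {a \<in> kerd n. \<forall>b\<in>K. ip a b = 0}"
  have Kl: "a \<in> ell2" if "a \<in> K" for a using that KN Nl by blast
  have dec: "\<exists>a\<in>K. \<exists>b\<in>K'. x = (\<lambda>k. a k + b k)" if x: "x \<in> kerd n" for x
  proof -
    obtain g where g: "g \<in> K" "\<forall>h\<in>K. ip (\<lambda>k. x k - g k) h = 0"
      using projection_exists[OF cl Nl[OF x]] by blast
    have "(\<lambda>k. x k - g k) \<in> K'"
      unfolding K'_def using g KN x subsp_diff[OF subsp_kerd] by blast
    then show ?thesis using g(1) by (intro bexI[of _ g] bexI[of _ "\<lambda>k. x k - g k"]) auto
  qed
  have "reducing n K'"
    unfolding reducing_def
  proof (intro conjI ballI impI)
    show "subsp K'"
      using subsp_kerd[of n] Kl Nl unfolding subsp_def K'_def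
      by (auto simp: ip_add_left ip_scale_left)
    show "K' \<subseteq> kerd n" by (auto simp: K'_def)
  next
    fix a assume a: "a \<in> K'"
    then have aN: "a \<in> kerd n" by (simp add: K'_def)
    \<comment> \<open>Up to conjugation this is the pairing of \<open>z b\<close> with
      \<open>a\<close>. As \<open>a\<close> is in \<open>kerd n\<close>, \<open>z b\<close> may be
      replaced by its projection, which lies in \<open>K\<close>.\<close>
    have "ip (backz a) b = 0" if b: "b \<in> K" for b
    proof -
      obtain g where g: "g \<in> kerd n" "\<forall>h\<in>kerd n. ip (\<lambda>k. mulz b k - g k) h = 0"
        using projection_exists[OF clN ell2_mulz[OF Kl[OF b]]] by blast
      have "g \<in> K" by (rule fz[OF b g(1)]) (use g in blast)
      then have "ip a g = 0" using a by (simp add: K'_def)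
      moreover have "ip (mulz b) a - ip g a = 0"
        using g aN Nl Kl[OF b] by (subst ip_diff_left[symmetric]) auto
      ultimately have "ip (mulz b) a = 0" by (simp add: ip_commute[of g a])
      then show ?thesis by (simp add: ip_mulz ip_commute[of _ b])
    qed
    then show "backz a \<in> K'" using backz_kerd[OF aN] by (simp add: K'_def)
  next
    fix a g assume a: "a \<in> K'" and g: "g \<in> kerd n"
      and gp: "\<forall>h\<in>kerd n. ip (\<lambda>k. mulz a k - g k) h = 0"
    have al: "a \<in> ell2" using a Nl[of a n] by (simp add: K'_def)
    \<comment> \<open>Replacing \<open>g\<close> by \<open>z a\<close> does not change the pairing
      with \<open>b\<close>, and \<open>ip (mulz a) b = ip a (backz b)\<close> with
      \<open>backz b\<close> in \<open>K\<close>.\<close>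
    have "ip g b = 0" if b: "b \<in> K" for b
    proof -
      have "ip (mulz a) b - ip g b = 0"
        using gp b KN al Nl[OF g] Kl[OF b] by (subst ip_diff_left[symmetric]) auto
      then show ?thesis using a bz[OF b] by (simp add: ip_mulz K'_def)
    qed
    then show "g \<in> K'" using g by (simp add: K'_def)
  qed
  moreover have "ip a b = 0" if "a \<in> K" "b \<in> K'" for a b
    using that ip_commute[of a b] by (simp add: K'_def)
  ultimately have "complementary n K K'"
    unfolding complementary_def using K dec by blast
  from complementary_cases[OF this n] show ?thesis
  proof
    assume "K' = {\<lambda>_. 0}"
    then have "kerd n \<subseteq> K" using dec by fastforce
    then show ?thesis using KN by blast
  qed simp
qed

section \<open>Taylor coefficients of functions in the Hardy space\<close>

text \<open>A nonzero coefficient of positive index would make the zeros of the sum near 0 isolated;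
  the constant coefficient is read off at \<open>z = 0\<close>.\<close>

lemma powser_zero_unique:
  fixes g :: "nat \<Rightarrow> complex"
  assumes "\<And>z. norm z < 1 \<Longrightarrow> ((\<lambda>i. g i * z ^ i) has_sum 0) UNIV"
  shows "g m = 0"
proof (cases "m = 0")
  case True
  have "(\<lambda>i. g i * 0 ^ i) sums 0" using assms[of 0] has_sum_imp_sums by force
  then show ?thesis using True by simp
next
  case False
  show ?thesis
  proof (rule ccontr)
    assume gm: "g m \<noteq> 0"
    have ser: "(\<lambda>i. g i * (z - 0) ^ i) sums 0" if "norm (z - 0) < 1" for z
      using has_sum_imp_sums[OF assms[of z]] that by simp
    show False
    proof (rule powser_0_nonzero[of 1 0 g "\<lambda>_. 0" m])
      fix s :: real
      assume s: "0 < s" "\<And>z::complex. z \<in> cball 0 s - {0} \<Longrightarrow> (0::complex) \<noteq> 0"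
      have "complex_of_real s \<in> cball 0 s - {0}" using s(1) by simp
      from s(2)[OF this] show False by simp
    next
      show "(\<lambda>i. g i * (z - 0) ^ i) sums 0" if "norm (z - 0) < 1" for z
        using that by (rule ser)
    qed (use gm False in simp_all)
  qed
qed

text \<open>One-variable uniqueness is applied in \<open>z\<close>, with the row sums as
  coefficients, and then in \<open>w\<close> to each row.\<close>

lemma power_series_zero_unique:
  assumes "has_power_series (\<lambda>_. 0) a"
  shows "a = (\<lambda>_. 0)"
proof -
  have sm: "((\<lambda>(i, j). a (i, j) * z ^ i * w ^ j) has_sum 0) UNIV" if "norm z < 1" "norm w < 1" for z w
    using assms that unfolding has_power_series_def bidisk_def by auto
  \<comment> \<open>Any nonzero \<open>z\<close> in the disk serves here; the factor
    \<open>(1/2)^i\<close> is then cancelled.\<close>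
  have row: "(\<lambda>j. a (i, j) * w ^ j) summable_on UNIV" if w: "norm w < 1" for i w
  proof -
    have "(\<lambda>(i, j). a (i, j) * (1/2) ^ i * w ^ j) summable_on Sigma UNIV (\<lambda>_. UNIV)"
      using sm[of "1/2" w] w by (auto simp: summable_on_def norm_divide)
    then have "(\<lambda>j. a (i, j) * (1/2) ^ i * w ^ j) summable_on UNIV"
      by (rule summable_on_SigmaD1) auto
    then have "(\<lambda>j. 2 ^ i * (a (i, j) * (1/2) ^ i * w ^ j)) summable_on UNIV"
      by (rule summable_on_cmult_right)
    then show ?thesis by (simp add: power_divide)
  qed
  have "(\<Sum>\<^sub>\<infinity>j. a (i, j) * w ^ j) = 0" if w: "norm w < 1" for i w
  proof (rule powser_zero_unique)
    fix z :: complex assume z: "norm z < 1"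
    have "((\<lambda>(i, j). a (i, j) * z ^ i * w ^ j) has_sum 0) (Sigma UNIV (\<lambda>_. UNIV))"
      using sm[OF z w] by simp
    then show "((\<lambda>i. (\<Sum>\<^sub>\<infinity>j. a (i, j) * w ^ j) * z ^ i) has_sum 0) UNIV"
    proof (rule has_sum_SigmaD)
      fix i
      have "((\<lambda>j. a (i, j) * w ^ j * z ^ i) has_sum (\<Sum>\<^sub>\<infinity>j. a (i, j) * w ^ j) * z ^ i) UNIV"
        using row[OF w] by (intro has_sum_cmult_left has_sum_infsum)
      then show "((\<lambda>j. case (i, j) of (i, j) \<Rightarrow> a (i, j) * z ^ i * w ^ j) has_sum
          (\<Sum>\<^sub>\<infinity>j. a (i, j) * w ^ j) * z ^ i) UNIV"
        by (simp add: mult_ac)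
    qed
  qed
  then have "((\<lambda>j. a (i, j) * w ^ j) has_sum 0) UNIV" if "norm w < 1" for i w
    using has_sum_infsum[OF row[OF that, of i]] that by simp
  from powser_zero_unique[OF this] show ?thesis by auto
qed

lemma has_power_series_add:
  assumes "has_power_series f a" "has_power_series g b"
  shows "has_power_series (\<lambda>x. f x + g x) (\<lambda>k. a k + b k)"
  unfolding has_power_series_def
proof clarify
  fix z w :: complex assume "(z, w) \<in> bidisk"
  with assms have "((\<lambda>(i, j). a (i, j) * z ^ i * w ^ j) has_sum f (z, w)) UNIV"
    "((\<lambda>(i, j). b (i, j) * z ^ i * w ^ j) has_sum g (z, w)) UNIV"
    unfolding has_power_series_def by blast+
  from has_sum_add[OF this]
  show "((\<lambda>(i, j). (a (i, j) + b (i, j)) * z ^ i * w ^ j) has_sum f (z, w) + g (z, w)) UNIV"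
    by (simp add: case_prod_unfold algebra_simps)
qed

lemma has_power_series_scale:
  assumes "has_power_series f a"
  shows "has_power_series (\<lambda>x. c * f x) (\<lambda>k. c * a k)"
  unfolding has_power_series_def
proof clarify
  fix z w :: complex assume "(z, w) \<in> bidisk"
  with assms have "((\<lambda>(i, j). a (i, j) * z ^ i * w ^ j) has_sum f (z, w)) UNIV"
    unfolding has_power_series_def by blast
  from has_sum_cmult_right[OF this, of c]
  show "((\<lambda>(i, j). c * a (i, j) * z ^ i * w ^ j) has_sum c * f (z, w)) UNIV"
    by (simp add: case_prod_unfold algebra_simps)
qed

lemma has_power_series_diff:
  assumes "has_power_series f a" "has_power_series g b"
  shows "has_power_series (\<lambda>x. f x - g x) (\<lambda>k. a k - b k)"
  using has_power_series_add[OF assms(1) has_power_series_scale[OF assms(2), of "-1"]] by simp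

lemma has_power_series_unique:
  assumes "has_power_series f a" "has_power_series f b"
  shows "a = b"
proof -
  have "has_power_series (\<lambda>_. 0) (\<lambda>k. a k - b k)"
    using has_power_series_diff[OF assms] by simp
  from power_series_zero_unique[OF this] show ?thesis by (auto simp: fun_eq_iff)
qed

lemma taylor_coeff_eq: "has_power_series f a \<Longrightarrow> taylor_coeff f = a"
  unfolding taylor_coeff_def by (rule the_equality) (simp_all add: has_power_series_unique)

lemma has_power_series_mulz:
  assumes "has_power_series f a"
  shows "has_power_series (mult_z f) (mulz a)"
  unfolding has_power_series_def
proof clarify
  fix z w :: complex assume "(z, w) \<in> bidisk"
  with assms have "((\<lambda>(i, j). a (i, j) * z ^ i * w ^ j) has_sum f (z, w)) UNIV"
    unfolding has_power_series_def by blast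
  from has_sum_cmult_right[OF this, of z]
  have *: "((\<lambda>(i, j). z * (a (i, j) * z ^ i * w ^ j)) has_sum z * f (z, w)) UNIV"
    by (simp add: case_prod_unfold)
  have "((\<lambda>(i, j). mulz a (i, j) * z ^ i * w ^ j) has_sum z * f (z, w)) (range (\<lambda>(i, j). (Suc i, j)))"
    by (subst has_sum_reindex[OF inj_sucs(1)])
       (use * in \<open>simp add: o_def case_prod_unfold mulz_def mult_ac\<close>)
  moreover have "((\<lambda>(i, j). mulz a (i, j) * z ^ i * w ^ j) has_sum z * f (z, w)) (range (\<lambda>(i, j). (Suc i, j)))
      = ((\<lambda>(i, j). mulz a (i, j) * z ^ i * w ^ j) has_sum z * f (z, w)) UNIV"
    by (rule has_sum_cong_neutral) (auto simp: mulz_def image_iff split: nat.splits)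
  ultimately show "((\<lambda>(i, j). mulz a (i, j) * z ^ i * w ^ j) has_sum mult_z f (z, w)) UNIV"
    by (simp add: mult_z_def)
qed

section \<open>The Hardy space as a space of square-summable coefficients\<close>

definition mkfun :: "coeffs \<Rightarrow> bifun" where
  "mkfun a = (\<lambda>(z, w). if (z, w) \<in> bidisk then \<Sum>\<^sub>\<infinity>(i, j). a (i, j) * z ^ i * w ^ j else 0)"

text \<open>Point evaluation is a pairing with this family, so square-summable coefficients give an
  absolutely convergent series on the bidisk.\<close>

lemma ell2_geometric:
  assumes "norm z < 1" "norm w < 1"
  shows "(\<lambda>(i, j). z ^ i * w ^ j) \<in> ell2"
proof -
  have geo: "((\<lambda>i. ((cmod z)\<^sup>2) ^ i) has_sum (1 / (1 - (cmod z)\<^sup>2))) UNIV" if "norm z < 1" for z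
  proof (rule sums_nonneg_imp_has_sum)
    have "(cmod z)\<^sup>2 < 1" using that by (simp add: power_less_one_iff)
    then show "(\<lambda>i. ((cmod z)\<^sup>2) ^ i) sums (1 / (1 - (cmod z)\<^sup>2))"
      by (intro geometric_sums) auto
  qed auto
  have "(\<lambda>(i, j). ((cmod z)\<^sup>2) ^ i * ((cmod w)\<^sup>2) ^ j) summable_on (Sigma UNIV (\<lambda>_. UNIV))"
  proof (rule summable_on_SigmaI)
    show "((\<lambda>j. case (i, j) of (i, j) \<Rightarrow> ((cmod z)\<^sup>2) ^ i * ((cmod w)\<^sup>2) ^ j) has_sum
        ((cmod z)\<^sup>2) ^ i * (1 / (1 - (cmod w)\<^sup>2))) UNIV" for i
      unfolding prod.case by (intro has_sum_cmult_right geo assms)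
    show "(\<lambda>i. ((cmod z)\<^sup>2) ^ i * (1 / (1 - (cmod w)\<^sup>2))) summable_on UNIV"
      using geo[OF assms(1)] by (intro summable_on_cmult_left) (auto simp: summable_on_def)
  qed auto
  then show ?thesis
    by (simp add: ell2_def case_prod_unfold norm_mult norm_power power_mult_distrib
        power_mult[symmetric] mult.commute)
qed

lemma mkfun_has_power_series:
  assumes "a \<in> ell2"
  shows "has_power_series (mkfun a) a"
  unfolding has_power_series_def
proof clarify
  fix z w :: complex assume zw: "(z, w) \<in> bidisk"
  then have "(\<lambda>(i, j). z ^ i * w ^ j) \<in> ell2"
    by (intro ell2_geometric) (auto simp: bidisk_def)
  from abs_summable_summable[OF ip_abs_summable[OF assms this]]
  have "(\<lambda>(i, j). a (i, j) * z ^ i * w ^ j) summable_on UNIV"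
    by (simp add: case_prod_unfold mult.assoc)
  then show "((\<lambda>(i, j). a (i, j) * z ^ i * w ^ j) has_sum mkfun a (z, w)) UNIV"
    using zw by (simp add: mkfun_def)
qed

lemma mkfun_hardy2: "a \<in> ell2 \<Longrightarrow> mkfun a \<in> hardy2"
  using mkfun_has_power_series[of a] by (auto simp: hardy2_def ell2_def mkfun_def)

lemma taylor_coeff_mkfun: "a \<in> ell2 \<Longrightarrow> taylor_coeff (mkfun a) = a"
  by (intro taylor_coeff_eq mkfun_has_power_series)

lemma hardy2_taylor:
  assumes "f \<in> hardy2"
  shows "taylor_coeff f \<in> ell2" "has_power_series f (taylor_coeff f)"
proof -
  obtain a where a: "a \<in> ell2" "has_power_series f a"
    using assms unfolding hardy2_def ell2_def by blast
  then show "taylor_coeff f \<in> ell2" "has_power_series f (taylor_coeff f)"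
    by (simp_all add: taylor_coeff_eq[OF a(2)])
qed

lemma hardy2_outside: "f \<in> hardy2 \<Longrightarrow> x \<notin> bidisk \<Longrightarrow> f x = 0"
  unfolding hardy2_def by blast

lemma hardy2_eqI:
  assumes "f \<in> hardy2" "g \<in> hardy2" "taylor_coeff f = taylor_coeff g"
  shows "f = g"
proof
  fix x :: "complex \<times> complex"
  show "f x = g x"
  proof (cases "x \<in> bidisk")
    case True
    obtain z w where x: "x = (z, w)" by (cases x)
    have "((\<lambda>(i, j). taylor_coeff f (i, j) * z ^ i * w ^ j) has_sum f x) UNIV"
      "((\<lambda>(i, j). taylor_coeff f (i, j) * z ^ i * w ^ j) has_sum g x) UNIV"
      using hardy2_taylor(2)[OF assms(1)] hardy2_taylor(2)[OF assms(2)] True x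
      unfolding has_power_series_def assms(3) by blast+
    then show ?thesis by (rule has_sum_unique)
  next
    case False
    then show ?thesis using assms by (simp add: hardy2_outside)
  qed
qed

lemma mkfun_taylor_coeff: "f \<in> hardy2 \<Longrightarrow> mkfun (taylor_coeff f) = f"
  by (intro hardy2_eqI mkfun_hardy2 taylor_coeff_mkfun) (auto intro: hardy2_taylor)

lemma hardy2I:
  "has_power_series f a \<Longrightarrow> a \<in> ell2 \<Longrightarrow> (\<And>x. x \<notin> bidisk \<Longrightarrow> f x = 0) \<Longrightarrow> f \<in> hardy2"
  by (auto simp: hardy2_def ell2_def)

lemma hardy2_add:
  assumes "f \<in> hardy2" "g \<in> hardy2"
  shows "(\<lambda>x. f x + g x) \<in> hardy2"
    "taylor_coeff (\<lambda>x. f x + g x) = (\<lambda>k. taylor_coeff f k + taylor_coeff g k)"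
proof -
  note ps = has_power_series_add[OF hardy2_taylor(2)[OF assms(1)] hardy2_taylor(2)[OF assms(2)]]
  show "(\<lambda>x. f x + g x) \<in> hardy2"
    by (rule hardy2I[OF ps]) (use assms in \<open>auto simp: hardy2_taylor hardy2_outside\<close>)
  show "taylor_coeff (\<lambda>x. f x + g x) = (\<lambda>k. taylor_coeff f k + taylor_coeff g k)"
    by (rule taylor_coeff_eq[OF ps])
qed

lemma hardy2_diff:
  assumes "f \<in> hardy2" "g \<in> hardy2"
  shows "(\<lambda>x. f x - g x) \<in> hardy2"
    "taylor_coeff (\<lambda>x. f x - g x) = (\<lambda>k. taylor_coeff f k - taylor_coeff g k)"
proof -
  note ps = has_power_series_diff[OF hardy2_taylor(2)[OF assms(1)] hardy2_taylor(2)[OF assms(2)]]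
  show "(\<lambda>x. f x - g x) \<in> hardy2"
    by (rule hardy2I[OF ps]) (use assms in \<open>auto simp: hardy2_taylor hardy2_outside\<close>)
  show "taylor_coeff (\<lambda>x. f x - g x) = (\<lambda>k. taylor_coeff f k - taylor_coeff g k)"
    by (rule taylor_coeff_eq[OF ps])
qed

lemma hardy2_scale:
  assumes "f \<in> hardy2"
  shows "(\<lambda>x. c * f x) \<in> hardy2"
    "taylor_coeff (\<lambda>x. c * f x) = (\<lambda>k. c * taylor_coeff f k)"
proof -
  note ps = has_power_series_scale[OF hardy2_taylor(2)[OF assms(1)]]
  show "(\<lambda>x. c * f x) \<in> hardy2"
    by (rule hardy2I[OF ps]) (use assms in \<open>auto simp: hardy2_taylor hardy2_outside\<close>)
  show "taylor_coeff (\<lambda>x. c * f x) = (\<lambda>k. c * taylor_coeff f k)"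
    by (rule taylor_coeff_eq[OF ps])
qed

lemma hardy2_mult_z:
  assumes "f \<in> hardy2"
  shows "mult_z f \<in> hardy2" "taylor_coeff (mult_z f) = mulz (taylor_coeff f)"
proof -
  note ps = has_power_series_mulz[OF hardy2_taylor(2)[OF assms(1)]]
  show "mult_z f \<in> hardy2"
    by (rule hardy2I[OF ps]) (use assms in \<open>auto simp: hardy2_taylor hardy2_outside mult_z_def\<close>)
  show "taylor_coeff (mult_z f) = mulz (taylor_coeff f)"
    by (rule taylor_coeff_eq[OF ps])
qed

lemma hardy2_zero: "(\<lambda>_. 0) \<in> hardy2" "taylor_coeff (\<lambda>_. 0) = (\<lambda>_. 0)"
proof -
  have ps: "has_power_series (\<lambda>_. 0) (\<lambda>_. 0)"
    by (simp add: has_power_series_def case_prod_unfold)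
  show "(\<lambda>_. 0) \<in> hardy2" by (rule hardy2I[OF ps]) auto
  show "taylor_coeff (\<lambda>_. 0) = (\<lambda>_. 0)" by (rule taylor_coeff_eq[OF ps])
qed

lemma h2_inner_eq: "h2_inner f g = ip (taylor_coeff f) (taylor_coeff g)"
  by (simp add: h2_inner_def ip_def)

lemma h2_norm_eq: "h2_norm f = sqrt (nsq (taylor_coeff f))"
  by (simp add: h2_norm_def h2_inner_eq ip_self)

lemma h2_norm_less:
  assumes "f \<in> hardy2" "g \<in> hardy2" "e > 0"
  shows "h2_norm (\<lambda>x. f x - g x) < e \<longleftrightarrow>
    nsq (\<lambda>k. taylor_coeff f k - taylor_coeff g k) < e\<^sup>2"
  using assms real_sqrt_less_iff[of _ "e\<^sup>2"] by (simp add: h2_norm_eq hardy2_diff)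

lemma closed_subsp_image:
  assumes "h2_closed_subspace M"
  shows "closed_subsp (taylor_coeff ` M)"
proof -
  have MH: "M \<subseteq> hardy2" and cl: "h2_closure M = M"
    and M0: "(\<lambda>_. 0) \<in> M" and Ma: "\<And>f g. f \<in> M \<Longrightarrow> g \<in> M \<Longrightarrow> (\<lambda>x. f x + g x) \<in> M"
    and Ms: "\<And>c f. f \<in> M \<Longrightarrow> (\<lambda>x. c * f x) \<in> M"
    using assms unfolding h2_closed_subspace_def by blast+
  have "subsp (taylor_coeff ` M)"
    unfolding subsp_def
  proof (intro conjI ballI allI)
    show "taylor_coeff ` M \<subseteq> ell2" using MH hardy2_taylor(1) by blast
    show "(\<lambda>_. 0) \<in> taylor_coeff ` M" using M0 hardy2_zero(2) by (metis imageI)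
  next
    fix a b assume "a \<in> taylor_coeff ` M" "b \<in> taylor_coeff ` M"
    then obtain f g where "f \<in> M" "g \<in> M" "a = taylor_coeff f" "b = taylor_coeff g" by blast
    then show "(\<lambda>k. a k + b k) \<in> taylor_coeff ` M"
      using Ma MH by (intro image_eqI[of _ _ "\<lambda>x. f x + g x"]) (auto simp: hardy2_add subset_iff)
  next
    fix c a assume "a \<in> taylor_coeff ` M"
    then obtain f where "f \<in> M" "a = taylor_coeff f" by blast
    then show "(\<lambda>k. c * a k) \<in> taylor_coeff ` M"
      using Ms MH by (intro image_eqI[of _ _ "\<lambda>x. c * f x"]) (auto simp: hardy2_scale subset_iff)
  qed
  moreover have "a \<in> taylor_coeff ` M"
    if a: "a \<in> ell2" and lim: "\<forall>e>0. \<exists>g\<in>taylor_coeff ` M. nsq (\<lambda>k. a k - g k) < e" for a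
  proof -
    have "\<exists>g\<in>M. h2_norm (\<lambda>x. mkfun a x - g x) < e" if e: "e > 0" for e
    proof -
      obtain g where g: "g \<in> M" "nsq (\<lambda>k. a k - taylor_coeff g k) < e\<^sup>2"
        using lim[rule_format, of "e\<^sup>2"] e by auto
      have "g \<in> hardy2" using g(1) MH by blast
      then have "h2_norm (\<lambda>x. mkfun a x - g x) < e"
        using g(2) a e by (simp add: h2_norm_less mkfun_hardy2 taylor_coeff_mkfun)
      then show ?thesis using g(1) by blast
    qed
    then have "mkfun a \<in> h2_closure M"
      using mkfun_hardy2[OF a] by (simp add: h2_closure_def)
    then have "mkfun a \<in> M" using cl by simp
    then show ?thesis using taylor_coeff_mkfun[OF a] by (metis imageI)
  qed
  ultimately show ?thesis unfolding closed_subsp_def by blast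
qed

text \<open>Orthogonality to a submodule can thus be tested on polynomial multiples of its
  generator.\<close>

lemma h2_orth_closure:
  assumes A: "A \<subseteq> hardy2"
  shows "h2_orth (h2_closure A) = h2_orth A"
proof -
  have "f \<in> h2_closure A" if "f \<in> A" for f
    using A that by (auto simp: h2_closure_def h2_norm_eq hardy2_zero nsq_def intro!: bexI[of _ f])
  moreover have "h2_inner f g = 0" if f: "f \<in> h2_orth A" and g: "g \<in> h2_closure A" for f g
  proof -
    have fH: "f \<in> hardy2" using f unfolding h2_orth_def by blast
    have gH: "g \<in> hardy2" and lim: "\<forall>e>0. \<exists>h\<in>A. h2_norm (\<lambda>x. g x - h x) < e"
      using g unfolding h2_closure_def by blast+
    have "ip (taylor_coeff g) (taylor_coeff f) = 0"
    proof (rule ip_closure)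
      fix e :: real assume e: "e > 0"
      obtain h where h: "h \<in> A" "h2_norm (\<lambda>x. g x - h x) < sqrt e"
        using lim[rule_format, of "sqrt e"] e by auto
      have hH: "h \<in> hardy2" using h(1) A by blast
      have "nsq (\<lambda>k. taylor_coeff g k - taylor_coeff h k) < e"
        using h(2) e h2_norm_less[OF gH hH, of "sqrt e"] by simp
      moreover have "ip (taylor_coeff h) (taylor_coeff f) = 0"
        using f h(1) by (simp add: h2_orth_def h2_inner_eq ip_commute[of "taylor_coeff h"])
      ultimately show "\<exists>h\<in>ell2. ip h (taylor_coeff f) = 0 \<and> nsq (\<lambda>k. taylor_coeff g k - h k) < e"
        using hardy2_taylor(1)[OF hH] by blast
    qed (use fH gH hardy2_taylor in auto)
    then show ?thesis by (simp add: h2_inner_eq ip_commute[of "taylor_coeff f"])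
  qed
  ultimately show ?thesis by (auto simp: h2_orth_def)
qed

section \<open>Polynomials as finitely supported coefficient families\<close>

definition polyc :: "complex poly poly \<Rightarrow> coeffs" where
  "polyc p = (\<lambda>(i, j). coeff (coeff p j) i)"

lemma polyc_nonzero_degree:
  assumes "polyc p (i, j) \<noteq> 0"
  shows "j \<le> degree p" "i \<le> degree (coeff p j)"
proof -
  have "coeff (coeff p j) i \<noteq> 0" using assms by (simp add: polyc_def)
  then show "i \<le> degree (coeff p j)" and "j \<le> degree p"
    by (auto intro: le_degree)
qed

lemma finite_polyc: "finite {k. polyc p k \<noteq> 0}"
proof (rule finite_subset)
  show "{k. polyc p k \<noteq> 0} \<subseteq> (SIGMA j:{..degree p}. {..degree (coeff p j)})\<inverse>"
    by (auto dest: polyc_nonzero_degree)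
qed auto

lemma ell2_polyc: "polyc p \<in> ell2"
  by (intro ell2_finite_support finite_polyc)

lemma bipoly_fun_power_series: "has_power_series (bipoly_fun p) (polyc p)"
  unfolding has_power_series_def
proof clarify
  fix z w :: complex assume zw: "(z, w) \<in> bidisk"
  \<comment> \<open>The degree bound in \<open>z\<close> depends on the power of \<open>w\<close>,
    so the support is indexed with \<open>j\<close> first and the pairs are swapped
    afterwards.\<close>
  let ?S = "SIGMA j:{..degree p}. {..degree (coeff p j)}"
  have "bipoly_fun p (z, w) = (\<Sum>j\<le>degree p. \<Sum>i\<le>degree (coeff p j). coeff (coeff p j) i * z ^ i * w ^ j)"
    using zw by (simp add: bipoly_fun_def poly_altdef[of p] poly_sum poly_power poly_altdef[of "coeff p _"] sum_distrib_right)
  also have "\<dots> = (\<Sum>(j, i)\<in>?S. polyc p (i, j) * z ^ i * w ^ j)"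
    by (simp add: sum.Sigma polyc_def)
  also have "\<dots> = (\<Sum>(i, j)\<in>?S\<inverse>. polyc p (i, j) * z ^ i * w ^ j)"
    by (rule sum.reindex_bij_witness[of _ prod.swap prod.swap]) auto
  finally show "((\<lambda>(i, j). polyc p (i, j) * z ^ i * w ^ j) has_sum bipoly_fun p (z, w)) UNIV"
  proof (intro has_sum_finite_neutralI[of "?S\<inverse>"])
    show "(case x of (i, j) \<Rightarrow> polyc p (i, j) * z ^ i * w ^ j) = 0" if "x \<in> UNIV - ?S\<inverse>" for x
      using that polyc_nonzero_degree[of p "fst x" "snd x"] by (cases x) auto
  qed auto
qed

lemma bipoly_fun_hardy2: "bipoly_fun p \<in> hardy2" "taylor_coeff (bipoly_fun p) = polyc p"
  using hardy2I[OF bipoly_fun_power_series ell2_polyc] taylor_coeff_eq[OF bipoly_fun_power_series]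
  by (auto simp: bipoly_fun_def)

lemma polyc_mult: "polyc ((var_z - var_w) * p) = muld (polyc p)"
proof -
  \<comment> \<open>\<open>var_z\<close> is constant in the outer variable and acts as a scalar,
    while \<open>var_w\<close> shifts the outer coefficients.\<close>
  have "(var_z - var_w) * p = smult [:0, 1:] p - pCons 0 p"
    by (simp add: var_z_def var_w_def algebra_simps)
  then have "polyc ((var_z - var_w) * p) (i, j) = muld (polyc p) (i, j)" for i j
    by (simp add: polyc_def muld_apply coeff_pCons split: nat.splits)
  then show ?thesis by auto
qed

lemma polyc_mult_pow: "polyc ((var_z - var_w) ^ n * p) = (muld ^^ n) (polyc p)"
  by (induction n) (simp_all add: polyc_mult mult.assoc)

lemma polyc_monom: "polyc (monom (monom 1 i) j) = deltac (i, j)"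
  by (auto simp: polyc_def deltac_def)

section \<open>The quotient module\<close>

text \<open>Pairing \<open>a\<close> with \<open>(z - w)^n z^i w^j\<close> gives the
  \<open>(i, j)\<close> entry of \<open>D^n a\<close>. Written as an orthogonal complement,
  \<open>kerd n\<close> is visibly closed.\<close>

lemma kerd_eq_orth: "kerd n = {a \<in> ell2. \<forall>g\<in>range (\<lambda>k. (muld ^^ n) (deltac k)). ip a g = 0}"
proof -
  have "ip a ((muld ^^ n) (deltac k)) = (backd ^^ n) a k" if "a \<in> ell2" for a k
    unfolding ip_commute[of a] using that by (simp add: ip_muld_pow ip_deltac)
  then show ?thesis by (auto simp: kerd_def fun_eq_iff)
qed

lemma closed_subsp_kerd: "closed_subsp (kerd n)"
  unfolding kerd_eq_orth by (rule closed_subsp_orth) auto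

lemma quotient_module_eq:
  "h2_orth (submodule_gen ((var_z - var_w) ^ n)) = {f \<in> hardy2. taylor_coeff f \<in> kerd n}"
proof -
  let ?A = "{bipoly_fun ((var_z - var_w) ^ n * q) | q. True}"
  have "h2_orth (submodule_gen ((var_z - var_w) ^ n)) = h2_orth ?A"
    unfolding submodule_gen_def by (rule h2_orth_closure) (auto simp: bipoly_fun_hardy2)
  also have "\<dots> = {f \<in> hardy2. \<forall>q. ip (taylor_coeff f) ((muld ^^ n) (polyc q)) = 0}"
    by (auto simp: h2_orth_def h2_inner_eq bipoly_fun_hardy2 polyc_mult_pow)
  also have "\<dots> = {f \<in> hardy2. taylor_coeff f \<in> kerd n}"
  proof (rule Collect_cong, rule conj_cong[OF refl])
    fix f assume "f \<in> hardy2"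
    then have l: "taylor_coeff f \<in> ell2" by (rule hardy2_taylor)
    have ip: "ip (taylor_coeff f) ((muld ^^ n) (polyc q)) = cnj (ip (polyc q) ((backd ^^ n) (taylor_coeff f)))" for q
      unfolding ip_commute[of "taylor_coeff f"] using l ell2_polyc by (simp add: ip_muld_pow)
    show "(\<forall>q. ip (taylor_coeff f) ((muld ^^ n) (polyc q)) = 0) \<longleftrightarrow> taylor_coeff f \<in> kerd n"
    proof
      assume *: "\<forall>q. ip (taylor_coeff f) ((muld ^^ n) (polyc q)) = 0"
      have "(backd ^^ n) (taylor_coeff f) (i, j) = 0" for i j
        using *[rule_format, of "monom (monom 1 i) j", unfolded ip] by (simp add: polyc_monom ip_deltac)
      then show "taylor_coeff f \<in> kerd n" using l by (auto simp: kerd_def)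
    next
      assume "taylor_coeff f \<in> kerd n"
      then show "\<forall>q. ip (taylor_coeff f) ((muld ^^ n) (polyc q)) = 0"
        by (simp add: ip kerd_def)
    qed
  qed
  finally show ?thesis .
qed

text \<open>This resolves the definite description in \<open>h2_proj\<close>: two candidates differ
  by a vector of \<open>kerd n\<close> that is orthogonal to itself.\<close>

lemma h2_proj_unique:
  assumes N: "N = {f \<in> hardy2. taylor_coeff f \<in> kerd n}" and f: "f \<in> hardy2"
    and a: "a \<in> kerd n" "\<And>h. h \<in> kerd n \<Longrightarrow> ip (\<lambda>k. taylor_coeff f k - a k) h = 0"
  shows "h2_proj N f = mkfun a"
  unfolding h2_proj_def
proof (rule the_equality)
  note al = kerd_ell2[OF a(1)]
  show "mkfun a \<in> N \<and> (\<forall>h\<in>N. h2_inner (\<lambda>x. f x - mkfun a x) h = 0)"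
    using a al f N by (simp add: mkfun_hardy2 taylor_coeff_mkfun h2_inner_eq hardy2_diff)
next
  fix g assume g: "g \<in> N \<and> (\<forall>h\<in>N. h2_inner (\<lambda>x. f x - g x) h = 0)"
  note al = kerd_ell2[OF a(1)]
  have gH: "g \<in> hardy2" and gN: "taylor_coeff g \<in> kerd n" using g N by auto
  let ?d = "\<lambda>k. a k - taylor_coeff g k"
  have d: "?d \<in> kerd n" by (rule subsp_diff[OF subsp_kerd a(1) gN])
  then have "mkfun ?d \<in> N" using N kerd_ell2 by (simp add: mkfun_hardy2 taylor_coeff_mkfun)
  then have "ip (\<lambda>k. taylor_coeff f k - taylor_coeff g k) ?d = 0"
    using g f gH kerd_ell2[OF d] by (auto simp: h2_inner_eq hardy2_diff taylor_coeff_mkfun)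
  moreover have "ip (\<lambda>k. taylor_coeff f k - a k) ?d = 0" by (rule a(2)[OF d])
  moreover have "ip (\<lambda>k. (taylor_coeff f k - taylor_coeff g k) - (taylor_coeff f k - a k)) ?d =
      ip (\<lambda>k. taylor_coeff f k - taylor_coeff g k) ?d - ip (\<lambda>k. taylor_coeff f k - a k) ?d"
    by (intro ip_diff_left ell2_diff al hardy2_taylor f gH)
  ultimately have "ip ?d ?d = 0" by simp
  then have "?d = (\<lambda>_. 0)" using kerd_ell2[OF d] by (intro ip_self_eq_0)
  then have "taylor_coeff g = a" by (auto simp: fun_eq_iff)
  then show "g = mkfun a" using mkfun_taylor_coeff[OF gH] by simp
qed

text \<open>Against \<open>g\<close> in \<open>N\<close> the projection in \<open>S_z\<close>
  disappears, leaving the adjoint \<open>backz\<close> of \<open>mulz\<close>, which maps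
  \<open>kerd n\<close> into itself.\<close>

lemma adjoint_on_compression:
  assumes N: "N = {f \<in> hardy2. taylor_coeff f \<in> kerd n}" and g: "g \<in> N"
  shows "adjoint_on N (compression N mult_z) g = mkfun (backz (taylor_coeff g))"
  unfolding adjoint_on_def
proof (rule the_equality)
  have gN: "taylor_coeff g \<in> kerd n" using g N by blast
  note bN = backz_kerd[OF gN]
  note bl = kerd_ell2[OF bN]
  have adj: "h2_inner (compression N mult_z f) g = ip (taylor_coeff f) (backz (taylor_coeff g))"
    if f: "f \<in> N" for f
  proof -
    have fH: "f \<in> hardy2" using f N by blast
    obtain a where a: "a \<in> kerd n" "\<forall>h\<in>kerd n. ip (\<lambda>k. mulz (taylor_coeff f) k - a k) h = 0"
      using projection_exists[OF closed_subsp_kerd ell2_mulz[OF hardy2_taylor(1)[OF fH]]] by blast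
    have "h2_proj N (mult_z f) = mkfun a"
      using a by (intro h2_proj_unique[OF N]) (auto simp: hardy2_mult_z fH)
    then have "h2_inner (compression N mult_z f) g = ip a (taylor_coeff g)"
      using kerd_ell2[OF a(1)] by (simp add: compression_def h2_inner_eq taylor_coeff_mkfun)
    also have "\<dots> = ip (mulz (taylor_coeff f)) (taylor_coeff g)"
    proof -
      have "ip (mulz (taylor_coeff f)) (taylor_coeff g) - ip a (taylor_coeff g) =
          ip (\<lambda>k. mulz (taylor_coeff f) k - a k) (taylor_coeff g)"
        by (intro ip_diff_left[symmetric] ell2_mulz hardy2_taylor fH kerd_ell2[OF a(1)] kerd_ell2[OF gN])
      also have "\<dots> = 0" using a(2) gN by blast
      finally show ?thesis by simp
    qed
    finally show ?thesis by (simp add: ip_mulz)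
  qed
  show "mkfun (backz (taylor_coeff g)) \<in> N \<and>
      (\<forall>f\<in>N. h2_inner (compression N mult_z f) g = h2_inner f (mkfun (backz (taylor_coeff g))))"
    using bN bl adj N by (simp add: mkfun_hardy2 taylor_coeff_mkfun h2_inner_eq)
  fix h assume h: "h \<in> N \<and> (\<forall>f\<in>N. h2_inner (compression N mult_z f) g = h2_inner f h)"
  have hH: "h \<in> hardy2" and hN: "taylor_coeff h \<in> kerd n" using h N by auto
  let ?d = "\<lambda>k. backz (taylor_coeff g) k - taylor_coeff h k"
  have d: "?d \<in> kerd n" by (rule subsp_diff[OF subsp_kerd bN hN])
  note dl = kerd_ell2[OF d]
  have dN: "mkfun ?d \<in> N" using N d dl by (simp add: mkfun_hardy2 taylor_coeff_mkfun)
  have "ip ?d (backz (taylor_coeff g)) = ip ?d (taylor_coeff h)"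
    using adj[OF dN] h dN dl by (simp add: h2_inner_eq taylor_coeff_mkfun)
  then have "ip ?d ?d = 0"
    using ip_diff_right[OF bl kerd_ell2[OF hN] dl] by simp
  then have "?d = (\<lambda>_. 0)" using dl by (intro ip_self_eq_0)
  then have "taylor_coeff h = backz (taylor_coeff g)" by (auto simp: fun_eq_iff)
  then show "h = mkfun (backz (taylor_coeff g))" using mkfun_taylor_coeff[OF hH] by simp
qed

theorem theorem5p9:
  fixes n :: nat and N :: "bifun set" and S\<^sub>z :: "bifun \<Rightarrow> bifun"
  assumes "n \<ge> 1"
    and "N = h2_orth (submodule_gen ((var_z - var_w) ^ n))"
    and "S\<^sub>z = compression N mult_z"
  shows "irreducible_on N S\<^sub>z"
  unfolding irreducible_on_def
proof (intro allI impI)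
  have N: "N = {f \<in> hardy2. taylor_coeff f \<in> kerd n}"
    unfolding assms(2) by (rule quotient_module_eq)
  fix M
  assume M: "h2_closed_subspace M \<and> M \<subseteq> N \<and> (\<forall>f\<in>M. S\<^sub>z f \<in> M) \<and> (\<forall>f\<in>M. adjoint_on N S\<^sub>z f \<in> M)"
  let ?K = "taylor_coeff ` M"
  have cl: "closed_subsp ?K" using M by (blast intro: closed_subsp_image)
  have MN: "M \<subseteq> N" using M by blast
  then have MH: "M \<subseteq> hardy2" using N by blast
  \<comment> \<open>Both invariance conditions on \<open>M\<close> transfer to coefficients, since
    \<open>mkfun\<close> of the relevant sequence is the value of the adjoint or of the
    compression.\<close>
  have "reducing n ?K"
    unfolding reducing_def
  proof (intro conjI ballI impI)
    show "subsp ?K" using cl by (simp add: closed_subsp_def)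
    show "?K \<subseteq> kerd n" using MN N by blast
  next
    fix a assume "a \<in> ?K"
    then obtain f where f: "f \<in> M" "a = taylor_coeff f" by blast
    have fN: "f \<in> N" using f MN by blast
    then have "backz a \<in> ell2" using f N by (auto intro: kerd_ell2)
    moreover have "mkfun (backz a) \<in> M"
      using M f adjoint_on_compression[OF N fN] by (auto simp: assms(3))
    ultimately show "backz a \<in> ?K" by (metis imageI taylor_coeff_mkfun)
  next
    fix a g assume "a \<in> ?K" and g: "g \<in> kerd n" "\<forall>h\<in>kerd n. ip (\<lambda>k. mulz a k - g k) h = 0"
    then obtain f where f: "f \<in> M" "a = taylor_coeff f" by blast
    have fH: "f \<in> hardy2" using f MH by blast
    have "h2_proj N (mult_z f) = mkfun g"
      using g f by (intro h2_proj_unique[OF N]) (auto simp: hardy2_mult_z fH)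
    then have "mkfun g \<in> M" using M f by (auto simp: assms(3) compression_def)
    then show "g \<in> ?K" using kerd_ell2[OF g(1)] by (metis imageI taylor_coeff_mkfun)
  qed
  from reducing_kerd_trivial[OF this cl closed_subsp_kerd assms(1)]
  show "M = {\<lambda>_. 0} \<or> M = N"
  proof
    assume K: "?K = {\<lambda>_. 0}"
    have "f = (\<lambda>_. 0)" if "f \<in> M" for f
      using that K MH hardy2_zero by (intro hardy2_eqI) auto
    moreover have "(\<lambda>_. 0) \<in> M" using M unfolding h2_closed_subspace_def by blast
    ultimately show ?thesis by blast
  next
    assume K: "?K = kerd n"
    \<comment> \<open>A function in \<open>hardy2\<close> is determined by its coefficients, so
      equality of the coefficient spaces gives \<open>M = N\<close>.\<close>
    have "f \<in> M" if "f \<in> N" for f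
    proof -
      have fH: "f \<in> hardy2" and "taylor_coeff f \<in> ?K" using that N K by auto
      then obtain g where g: "g \<in> M" "taylor_coeff g = taylor_coeff f" by force
      then have "g = f" using MH fH by (intro hardy2_eqI) auto
      then show ?thesis using g(1) by simp
    qed
    then show ?thesis using MN by blast
  qed
qed

end
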